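(* Let $G_1,G_2,G_3$ be groups. There is a natural one-to-one correspondence between the degenerate 2-factor injective subdirect products $\Delta$ of $G_1 \times G_2 \times G_3$ and the tuples $(B_1,B_2,B_3,C_1,C_2,C_3,\varphi_1,\varphi_2,\varphi_3)$ for which for all $i\in \{1,2,3\}$ (indices taken modulo 3) we have 1. $B_i,C_i \trianglelefteq G_i$, 2. $B_i \cap C_i = 1$, 3. $[B_i, C_i]= 1$, 4. $\varphi_i\colon G_i/C_i \to G_{i+1}/B_{i+1}$ is an isomorphism, 5. $\varphi_i(B_iC_i) = C_{i+1}B_{i+1}$, 6. $\varphi_3(\varphi_2(\varphi_1(g_1B_1C_1))) = g_1B_1C_1$ for all $g_1 \in G_1$. The correspondence sends $\Delta$ to the tuple with $B_i=\pi_i(H_{i+2})$, $C_i=\pi_i(H_{i+1})$ and $\varphi_i(g_iC_i)=g_{i+1}B_{i+1}$ for $(g_1,g_2,g_3)\in\Delta$; its inverse sends a tuple to $\{(g_1,g_2,g_3)\in G_1\times G_2\times G_3\mid \varphi_i(g_iC_i)=g_{i+1}B_{i+1}\text{ for all } i\in\{1,2,3\}\}$.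
   Context: For $\Delta\leq G_1\times G_2\times G_3$, $\pi_i$ is the projection to the $i$-th coordinate (restricted to $\Delta$) and $\psi_i$ is the homomorphism on $\Delta$ deleting the $i$-th coordinate. $\Delta$ is a subdirect product if $\pi_i(\Delta)=G_i$ for all $i$; it is 2-factor injective if all $\psi_i$ are injective. Put $H_i=\{(g_1,g_2,g_3)\in\Delta\mid g_i=1\}$. A subdirect product $\Delta$ is degenerate if $\pi_i(\ker\pi_{i+1})\cap\pi_i(\ker\pi_{i+2})=\pi_i(\ker\psi_i)$ for some, and thus every, $i\in\{1,2,3\}$ (kernels taken in $\Delta$); for 2-factor injective $\Delta$ this says $\pi_i(H_{i+1})\cap\pi_i(H_{i+2})=1$. Indices are modulo 3. $[B,C]=1$ means that $B$ and $C$ commute elementwise. Condition 5 means that $\varphi_i$ maps the subgroup $B_iC_i/C_i$ onto $C_{i+1}B_{i+1}/B_{i+1}$; in condition 6, $\varphi_i$ also denotes the induced isomorphism $G_i/B_iC_i\to G_{i+1}/B_{i+1}C_{i+1}$. *)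

theory Defs
  imports "HOL-Algebra.Coset"
begin

definition proj1 :: "'a \<times> 'b \<times> 'c \<Rightarrow> 'a" where "proj1 = (\<lambda>(g1, g2, g3). g1)"
definition proj2 :: "'a \<times> 'b \<times> 'c \<Rightarrow> 'b" where "proj2 = (\<lambda>(g1, g2, g3). g2)"
definition proj3 :: "'a \<times> 'b \<times> 'c \<Rightarrow> 'c" where "proj3 = (\<lambda>(g1, g2, g3). g3)"

definition del1 :: "'a \<times> 'b \<times> 'c \<Rightarrow> 'b \<times> 'c" where "del1 = (\<lambda>(g1, g2, g3). (g2, g3))"
definition del2 :: "'a \<times> 'b \<times> 'c \<Rightarrow> 'a \<times> 'c" where "del2 = (\<lambda>(g1, g2, g3). (g1, g3))"
definition del3 :: "'a \<times> 'b \<times> 'c \<Rightarrow> 'a \<times> 'b" where "del3 = (\<lambda>(g1, g2, g3). (g1, g2))"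

definition prod3 ::
  "('a, 'm) monoid_scheme \<Rightarrow> ('b, 'n) monoid_scheme \<Rightarrow> ('c, 'p) monoid_scheme \<Rightarrow> ('a \<times> 'b \<times> 'c) monoid"
  where "prod3 G1 G2 G3 = G1 \<times>\<times> (G2 \<times>\<times> G3)"

definition subdirect ::
  "('a, 'm) monoid_scheme \<Rightarrow> ('b, 'n) monoid_scheme \<Rightarrow> ('c, 'p) monoid_scheme \<Rightarrow> ('a \<times> 'b \<times> 'c) set \<Rightarrow> bool"
  where "subdirect G1 G2 G3 \<Delta> \<longleftrightarrow>
    subgroup \<Delta> (prod3 G1 G2 G3) \<and>
    proj1 ` \<Delta> = carrier G1 \<and> proj2 ` \<Delta> = carrier G2 \<and> proj3 ` \<Delta> = carrier G3"

definition two_factor_injective :: "('a \<times> 'b \<times> 'c) set \<Rightarrow> bool"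
  where "two_factor_injective \<Delta> \<longleftrightarrow> inj_on del1 \<Delta> \<and> inj_on del2 \<Delta> \<and> inj_on del3 \<Delta>"

definition degenerate ::
  "('a, 'm) monoid_scheme \<Rightarrow> ('b, 'n) monoid_scheme \<Rightarrow> ('c, 'p) monoid_scheme \<Rightarrow> ('a \<times> 'b \<times> 'c) set \<Rightarrow> bool"
  where "degenerate G1 G2 G3 \<Delta> \<longleftrightarrow>
    (let D = (prod3 G1 G2 G3)\<lparr>carrier := \<Delta>\<rparr> in
      proj1 ` kernel D G2 proj2 \<inter> proj1 ` kernel D G3 proj3 = proj1 ` kernel D (G2 \<times>\<times> G3) del1 \<or>
      proj2 ` kernel D G3 proj3 \<inter> proj2 ` kernel D G1 proj1 = proj2 ` kernel D (G1 \<times>\<times> G3) del2 \<or>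
      proj3 ` kernel D G1 proj1 \<inter> proj3 ` kernel D G2 proj2 = proj3 ` kernel D (G1 \<times>\<times> G2) del3)"

definition deg_2fi_subdirect ::
  "('a, 'm) monoid_scheme \<Rightarrow> ('b, 'n) monoid_scheme \<Rightarrow> ('c, 'p) monoid_scheme \<Rightarrow> ('a \<times> 'b \<times> 'c) set set"
  where "deg_2fi_subdirect G1 G2 G3 =
    {\<Delta>. subdirect G1 G2 G3 \<Delta> \<and> two_factor_injective \<Delta> \<and> degenerate G1 G2 G3 \<Delta>}"

definition H1 :: "('a, 'm) monoid_scheme \<Rightarrow> ('a \<times> 'b \<times> 'c) set \<Rightarrow> ('a \<times> 'b \<times> 'c) set"
  where "H1 G1 \<Delta> = {(g1, g2, g3). (g1, g2, g3) \<in> \<Delta> \<and> g1 = \<one>\<^bsub>G1\<^esub>}"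
definition H2 :: "('b, 'm) monoid_scheme \<Rightarrow> ('a \<times> 'b \<times> 'c) set \<Rightarrow> ('a \<times> 'b \<times> 'c) set"
  where "H2 G2 \<Delta> = {(g1, g2, g3). (g1, g2, g3) \<in> \<Delta> \<and> g2 = \<one>\<^bsub>G2\<^esub>}"
definition H3 :: "('c, 'm) monoid_scheme \<Rightarrow> ('a \<times> 'b \<times> 'c) set \<Rightarrow> ('a \<times> 'b \<times> 'c) set"
  where "H3 G3 \<Delta> = {(g1, g2, g3). (g1, g2, g3) \<in> \<Delta> \<and> g3 = \<one>\<^bsub>G3\<^esub>}"

text \<open>
  Cosets are written as right cosets, matching the library's factor group \<open>Mod\<close>; all subgroups
  involved are normal, so \<open>C #> g\<close> is the coset \<open>gC\<close>.

  The conditions on a tuple that concern a single index \<open>i\<close>, with \<open>G, B, C, \<phi>\<close> standing for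
  \<open>G\<^sub>i, B\<^sub>i, C\<^sub>i, \<phi>\<^sub>i\<close> and \<open>G', B', C'\<close> for \<open>G\<^sub>i\<^sub>+\<^sub>1, B\<^sub>i\<^sub>+\<^sub>1, C\<^sub>i\<^sub>+\<^sub>1\<close>.
  Extensionality fixes the value of \<open>\<phi>\<close> outside \<open>G/C\<close>, so that equality of HOL functions is
  equality of maps \<open>G/C \<rightarrow> G'/B'\<close>. The last clause says that \<open>\<phi>\<close> maps the subgroup \<open>BC/C\<close> of
  \<open>G/C\<close> onto the subgroup \<open>C'B'/B'\<close> of \<open>G'/B'\<close>.
\<close>
definition local_conditions ::
  "('a, 'm) monoid_scheme \<Rightarrow> 'a set \<Rightarrow> 'a set \<Rightarrow> ('b, 'n) monoid_scheme \<Rightarrow> 'b set \<Rightarrow> 'b set \<Rightarrow>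
    ('a set \<Rightarrow> 'b set) \<Rightarrow> bool"
  where "local_conditions G B C G' B' C' \<phi> \<longleftrightarrow>
    B \<lhd> G \<and> C \<lhd> G \<and>
    B \<inter> C = {\<one>\<^bsub>G\<^esub>} \<and>
    (\<forall>b\<in>B. \<forall>c\<in>C. b \<otimes>\<^bsub>G\<^esub> c = c \<otimes>\<^bsub>G\<^esub> b) \<and>
    \<phi> \<in> iso (G Mod C) (G' Mod B') \<and> \<phi> \<in> extensional (carrier (G Mod C)) \<and>
    \<phi> ` ((\<lambda>x. C #>\<^bsub>G\<^esub> x) ` (B <#>\<^bsub>G\<^esub> C)) = (\<lambda>y. B' #>\<^bsub>G'\<^esub> y) ` (C' <#>\<^bsub>G'\<^esub> B')"

text \<open>
  The map \<open>G/BC \<rightarrow> G'/B'C'\<close> induced by \<open>\<phi> : G/C \<rightarrow> G'/B'\<close>: a coset \<open>K\<close> of \<open>BC\<close> is a union of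
  cosets of \<open>C\<close>, and its image is the union of their \<open>\<phi>\<close>-images; see \<open>induced_coset\<close> below.
\<close>
definition induced :: "('a, 'm) monoid_scheme \<Rightarrow> 'a set \<Rightarrow> ('a set \<Rightarrow> 'b set) \<Rightarrow> 'a set \<Rightarrow> 'b set"
  where "induced G C \<phi> K = (\<Union>x\<in>K. \<phi> (C #>\<^bsub>G\<^esub> x))"

lemma induced_coset:
  assumes "group G" "group G'" and loc: "local_conditions G B C G' B' C' \<phi>"
    and C': "C' \<lhd> G'" and B': "B' \<lhd> G'"
    and g: "g \<in> carrier G" and h: "h \<in> carrier G'"
    and eq: "\<phi> (C #>\<^bsub>G\<^esub> g) = B' #>\<^bsub>G'\<^esub> h"
  shows "induced G C \<phi> ((B <#>\<^bsub>G\<^esub> C) #>\<^bsub>G\<^esub> g) = (B' <#>\<^bsub>G'\<^esub> C') #>\<^bsub>G'\<^esub> h"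
proof -
  interpret G: group G by fact
  interpret G': group G' by fact
  interpret C: normal C G using loc by (simp add: local_conditions_def)
  interpret B: normal B G using loc by (simp add: local_conditions_def)
  interpret B': normal B' G' by fact
  interpret C': normal C' G' by fact
  have hom: "\<phi> \<in> hom (G Mod C) (G' Mod B')"
    using loc by (auto simp: local_conditions_def iso_def)
  have im: "\<phi> ` ((\<lambda>x. C #>\<^bsub>G\<^esub> x) ` (B <#>\<^bsub>G\<^esub> C)) = (\<lambda>y. B' #>\<^bsub>G'\<^esub> y) ` (C' <#>\<^bsub>G'\<^esub> B')"
    using loc by (simp add: local_conditions_def)
  have BC: "B <#>\<^bsub>G\<^esub> C \<subseteq> carrier G"
    by (simp add: B.subset C.subset G.setmult_subset_G)
  have CB': "C' <#>\<^bsub>G'\<^esub> B' \<subseteq> carrier G'"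
    by (simp add: B'.subset C'.subset G'.setmult_subset_G)
  have comm: "C' <#>\<^bsub>G'\<^esub> B' = B' <#>\<^bsub>G'\<^esub> C'"
    using G'.commut_normal[OF C'.subgroup_axioms B'] by simp
  have step: "\<phi> (C #>\<^bsub>G\<^esub> (x \<otimes>\<^bsub>G\<^esub> g)) = \<phi> (C #>\<^bsub>G\<^esub> x) <#>\<^bsub>G'\<^esub> (B' #>\<^bsub>G'\<^esub> h)"
    if "x \<in> carrier G" for x
  proof -
    have "C #>\<^bsub>G\<^esub> (x \<otimes>\<^bsub>G\<^esub> g) = (C #>\<^bsub>G\<^esub> x) \<otimes>\<^bsub>G Mod C\<^esub> (C #>\<^bsub>G\<^esub> g)"
      using that g by (simp add: FactGroup_def C.rcos_sum)
    moreover have "C #>\<^bsub>G\<^esub> x \<in> carrier (G Mod C)" "C #>\<^bsub>G\<^esub> g \<in> carrier (G Mod C)"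
      using that g by (auto simp: FactGroup_def RCOSETS_def)
    ultimately show ?thesis
      using hom_mult[OF hom] eq by (simp add: FactGroup_def)
  qed
  have "induced G C \<phi> ((B <#>\<^bsub>G\<^esub> C) #>\<^bsub>G\<^esub> g)
      = (\<Union>x\<in>B <#>\<^bsub>G\<^esub> C. \<phi> (C #>\<^bsub>G\<^esub> (x \<otimes>\<^bsub>G\<^esub> g)))"
    by (auto simp: induced_def r_coset_def)
  also have "\<dots> = (\<Union>x\<in>B <#>\<^bsub>G\<^esub> C. \<phi> (C #>\<^bsub>G\<^esub> x) <#>\<^bsub>G'\<^esub> (B' #>\<^bsub>G'\<^esub> h))"
    using step BC by (intro SUP_cong) auto
  also have "\<dots> = (\<Union>Y\<in>\<phi> ` ((\<lambda>x. C #>\<^bsub>G\<^esub> x) ` (B <#>\<^bsub>G\<^esub> C)). Y <#>\<^bsub>G'\<^esub> (B' #>\<^bsub>G'\<^esub> h))"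
    by simp
  also have "\<dots> = (\<Union>y\<in>C' <#>\<^bsub>G'\<^esub> B'. (B' #>\<^bsub>G'\<^esub> y) <#>\<^bsub>G'\<^esub> (B' #>\<^bsub>G'\<^esub> h))"
    unfolding im by simp
  also have "\<dots> = (\<Union>y\<in>C' <#>\<^bsub>G'\<^esub> B'. B' #>\<^bsub>G'\<^esub> (y \<otimes>\<^bsub>G'\<^esub> h))"
    using CB' h by (intro SUP_cong) (auto simp: B'.rcos_sum)
  also have "\<dots> = B' <#>\<^bsub>G'\<^esub> ((C' <#>\<^bsub>G'\<^esub> B') #>\<^bsub>G'\<^esub> h)"
    by (auto simp: r_coset_def set_mult_def)
  also have "\<dots> = (B' <#>\<^bsub>G'\<^esub> (B' <#>\<^bsub>G'\<^esub> C')) #>\<^bsub>G'\<^esub> h"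
    using CB' h B'.subset by (simp add: G'.setmult_rcos_assoc comm)
  also have "B' <#>\<^bsub>G'\<^esub> (B' <#>\<^bsub>G'\<^esub> C') = B' <#>\<^bsub>G'\<^esub> C'"
    using B'.subset C'.subset G'.set_mult_assoc[of B' B' C']
    by (simp add: G'.subgroup_mult_id[OF B'.subgroup_axioms])
  finally show ?thesis .
qed

type_synonym ('a, 'b, 'c) gluing_data =
  "'a set \<times> 'b set \<times> 'c set \<times> 'a set \<times> 'b set \<times> 'c set \<times>
    ('a set \<Rightarrow> 'b set) \<times> ('b set \<Rightarrow> 'c set) \<times> ('c set \<Rightarrow> 'a set)"

definition gluing_tuples ::
  "('a, 'm) monoid_scheme \<Rightarrow> ('b, 'n) monoid_scheme \<Rightarrow> ('c, 'p) monoid_scheme \<Rightarrow>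
    ('a, 'b, 'c) gluing_data set"
  where "gluing_tuples G1 G2 G3 =
    {(B1, B2, B3, C1, C2, C3, \<phi>1, \<phi>2, \<phi>3).
      local_conditions G1 B1 C1 G2 B2 C2 \<phi>1 \<and>
      local_conditions G2 B2 C2 G3 B3 C3 \<phi>2 \<and>
      local_conditions G3 B3 C3 G1 B1 C1 \<phi>3 \<and>
      (\<forall>g1\<in>carrier G1.
        induced G3 C3 \<phi>3 (induced G2 C2 \<phi>2 (induced G1 C1 \<phi>1 ((B1 <#>\<^bsub>G1\<^esub> C1) #>\<^bsub>G1\<^esub> g1)))
          = (B1 <#>\<^bsub>G1\<^esub> C1) #>\<^bsub>G1\<^esub> g1)}"

end

theory Submission
  imports Defs
begin

text \<open>
  By Goursat's lemma, an isomorphism \<open>G/C \<rightarrow> H/B\<close> is the same as a subdirect product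
  \<open>T \<le> G \<times> H\<close> with \<open>C = {x. T x 1}\<close> and \<open>B = {y. T 1 y}\<close>. Thus \<open>\<phi>\<^sub>i\<close> corresponds to the
  projection of \<open>\<Delta>\<close> to two adjacent coordinates, whose kernels are \<open>C\<^sub>i\<close> and \<open>B\<^sub>i\<^sub>+\<^sub>1\<close>.
  If \<open>\<Delta>\<close> is degenerate, it is recovered from its three pairwise projections: given
  \<open>(a, b, z)\<close>, \<open>(x, b, c)\<close> and \<open>(a, y, c)\<close> in \<open>\<Delta>\<close>, the quotient \<open>cz\<^sup>-\<^sup>1\<close> lies in
  \<open>B\<^sub>3 \<inter> C\<^sub>3 = 1\<close>. Conversely, when three Goursat relations are glued, a pair in one of them extends
  to a triple that closes up modulo \<open>B\<^sub>1C\<^sub>1\<close> by condition 6, and the defect is absorbed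
  by changing a single coordinate, using condition 5.
\<close>

section \<open>Goursat's lemma\<close>

text \<open>A coset of the left kernel goes to the set of all partners of its elements, which
  \<open>image_coset\<close> identifies as one coset of the right kernel. Restricting to the
  quotient gives the extensionality demanded by \<open>local_conditions\<close>.\<close>

definition coset_map ::
  "('a, 'm) monoid_scheme \<Rightarrow> ('b, 'n) monoid_scheme \<Rightarrow> ('a \<Rightarrow> 'b \<Rightarrow> bool) \<Rightarrow> 'a set \<Rightarrow> 'b set"
  where "coset_map G H T = (\<lambda>K\<in>carrier (G Mod {x. T x \<one>\<^bsub>H\<^esub>}). {y. \<exists>x\<in>K. T x y})"

text \<open>A subdirect product of two groups, held as a predicate so that exchanging the factors
  merely permutes arguments. That the unit pair belongs to it follows from totality, in
  \<open>one\<close>.\<close>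

locale goursat_relation = G: group G + H: group H
  for G :: "('a, 'm) monoid_scheme" and H :: "('b, 'n) monoid_scheme" +
  fixes T :: "'a \<Rightarrow> 'b \<Rightarrow> bool"
  assumes left_carrier: "T x y \<Longrightarrow> x \<in> carrier G"
    and right_carrier: "T x y \<Longrightarrow> y \<in> carrier H"
    and mult: "T x y \<Longrightarrow> T x' y' \<Longrightarrow> T (x \<otimes>\<^bsub>G\<^esub> x') (y \<otimes>\<^bsub>H\<^esub> y')"
    and inverse: "T x y \<Longrightarrow> T (inv\<^bsub>G\<^esub> x) (inv\<^bsub>H\<^esub> y)"
    and left_total: "x \<in> carrier G \<Longrightarrow> \<exists>y. T x y"
    and right_total: "y \<in> carrier H \<Longrightarrow> \<exists>x. T x y"
begin

abbreviation lker where "lker \<equiv> {x. T x \<one>\<^bsub>H\<^esub>}"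
abbreviation rker where "rker \<equiv> {y. T \<one>\<^bsub>G\<^esub> y}"

text \<open>The axioms are symmetric in the two factors, so facts about \<open>rker\<close> and
  about the inverse map can be read off from those about \<open>lker\<close> and
  \<open>coset_map\<close>.\<close>

lemma swap: "goursat_relation H G (\<lambda>y x. T x y)"
  by unfold_locales (auto intro: left_carrier right_carrier mult inverse left_total right_total)

lemma one: "T \<one>\<^bsub>G\<^esub> \<one>\<^bsub>H\<^esub>"
  using left_total[OF G.one_closed] mult inverse left_carrier right_carrier
  by (metis G.r_inv H.r_inv)

lemma lker_normal: "lker \<lhd> G"
proof (rule G.normal_invI)
  show "subgroup lker G"
  proof (rule G.subgroupI)
    show "lker \<subseteq> carrier G" by (auto dest: left_carrier)
    show "lker \<noteq> {}" using one by auto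
    show "inv\<^bsub>G\<^esub> a \<in> lker" if "a \<in> lker" for a using inverse[of a "\<one>\<^bsub>H\<^esub>"] that by simp
    show "a \<otimes>\<^bsub>G\<^esub> b \<in> lker" if "a \<in> lker" "b \<in> lker" for a b
      using mult[of a "\<one>\<^bsub>H\<^esub>" b "\<one>\<^bsub>H\<^esub>"] that by simp
  qed
next
  fix x h assume x: "x \<in> carrier G" and h: "h \<in> lker"
  obtain y where y: "T x y" using left_total[OF x] by blast
  \<comment> \<open>The partner \<open>y\<close> of \<open>x\<close> comes from left totality;
    conjugating the unit by \<open>y\<close> leaves the unit.\<close>
  have "T (x \<otimes>\<^bsub>G\<^esub> h \<otimes>\<^bsub>G\<^esub> inv\<^bsub>G\<^esub> x) (y \<otimes>\<^bsub>H\<^esub> \<one>\<^bsub>H\<^esub> \<otimes>\<^bsub>H\<^esub> inv\<^bsub>H\<^esub> y)"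
    using h y by (intro mult inverse) auto
  then show "x \<otimes>\<^bsub>G\<^esub> h \<otimes>\<^bsub>G\<^esub> inv\<^bsub>G\<^esub> x \<in> lker"
    using right_carrier[OF y] by simp
qed

lemma rker_normal: "rker \<lhd> H"
  by (rule goursat_relation.lker_normal[OF swap])

lemma left_div:
  assumes "T x y" "T x' y" shows "T (x' \<otimes>\<^bsub>G\<^esub> inv\<^bsub>G\<^esub> x) \<one>\<^bsub>H\<^esub>"
  using mult[OF assms(2) inverse[OF assms(1)]] right_carrier[OF assms(1)] by simp

lemma right_div:
  assumes "T x y" "T x y'" shows "T \<one>\<^bsub>G\<^esub> (y' \<otimes>\<^bsub>H\<^esub> inv\<^bsub>H\<^esub> y)"
  using mult[OF assms(2) inverse[OF assms(1)]] left_carrier[OF assms(1)] by simp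

text \<open>Every element of the coset of \<open>x\<close> still has \<open>y\<close> as a partner,
  since left kernel elements are related to the unit, and two partners of one element differ by a
  right kernel element. Hence the induced map on cosets is well defined.\<close>

lemma image_coset:
  assumes "T x y" shows "{y'. \<exists>x'\<in>lker #>\<^bsub>G\<^esub> x. T x' y'} = rker #>\<^bsub>H\<^esub> y"
proof (intro equalityI subsetI)
  fix y' assume "y' \<in> {y'. \<exists>x'\<in>lker #>\<^bsub>G\<^esub> x. T x' y'}"
  then obtain c where c: "T c \<one>\<^bsub>H\<^esub>" and y': "T (c \<otimes>\<^bsub>G\<^esub> x) y'"
    by (auto simp: r_coset_def)
  have "T (c \<otimes>\<^bsub>G\<^esub> x) y"
    using mult[OF c assms] right_carrier[OF assms] by simp
  from right_div[OF this y'] show "y' \<in> rker #>\<^bsub>H\<^esub> y"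
    using right_carrier[OF assms] right_carrier[OF y'] 
    by (force simp: r_coset_def H.m_assoc)
next
  fix y' assume "y' \<in> rker #>\<^bsub>H\<^esub> y"
  then obtain b where b: "T \<one>\<^bsub>G\<^esub> b" "y' = b \<otimes>\<^bsub>H\<^esub> y" by (auto simp: r_coset_def)
  then have "T x y'" using mult[OF b(1) assms] left_carrier[OF assms] by simp
  moreover have "x \<in> lker #>\<^bsub>G\<^esub> x"
    using one left_carrier[OF assms] by (force simp: r_coset_def)
  ultimately show "y' \<in> {y'. \<exists>x'\<in>lker #>\<^bsub>G\<^esub> x. T x' y'}" by blast
qed

lemma coset_map_eq: "T x y \<Longrightarrow> coset_map G H T (lker #>\<^bsub>G\<^esub> x) = rker #>\<^bsub>H\<^esub> y"
  using image_coset[of x y] left_carrier[of x y]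
  by (auto simp: coset_map_def FactGroup_def RCOSETS_def)

text \<open>The map loses nothing: a partner \<open>y'\<close> of \<open>x\<close> lies in the same
  coset as \<open>y\<close>, and a right kernel element moves \<open>y'\<close> to \<open>y\<close>
  without changing \<open>x\<close>.\<close>

lemma coset_map_iff:
  assumes "x \<in> carrier G" "y \<in> carrier H"
  shows "coset_map G H T (lker #>\<^bsub>G\<^esub> x) = rker #>\<^bsub>H\<^esub> y \<longleftrightarrow> T x y"
proof
  assume eq: "coset_map G H T (lker #>\<^bsub>G\<^esub> x) = rker #>\<^bsub>H\<^esub> y"
  obtain y' where y': "T x y'" using left_total assms(1) by blast
  have "y \<in> rker #>\<^bsub>H\<^esub> y" using one assms(2) by (force simp: r_coset_def)
  then have "y \<in> rker #>\<^bsub>H\<^esub> y'" using eq coset_map_eq[OF y'] by simp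
  then obtain b where "T \<one>\<^bsub>G\<^esub> b" "y = b \<otimes>\<^bsub>H\<^esub> y'" by (auto simp: r_coset_def)
  then show "T x y" using mult[of "\<one>\<^bsub>G\<^esub>" b x y'] y' assms(1) by simp
qed (rule coset_map_eq)

lemma coset_map_iso: "coset_map G H T \<in> iso (G Mod lker) (H Mod rker)"
proof -
  interpret L: normal lker G by (rule lker_normal)
  interpret R: normal rker H by (rule rker_normal)
  interpret swap: goursat_relation H G "\<lambda>y x. T x y" by (rule swap)
  have dom: "\<exists>x y. T x y \<and> K = lker #>\<^bsub>G\<^esub> x" if K: "K \<in> carrier (G Mod lker)" for K
  proof -
    obtain x where "x \<in> carrier G" "K = lker #>\<^bsub>G\<^esub> x"
      using K by (auto simp: carrier_FactGroup)
    then show ?thesis using left_total by blast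
  qed
  have ran: "rker #>\<^bsub>H\<^esub> y \<in> carrier (H Mod rker)" if "T x y" for x y
    using right_carrier[OF that] by (auto simp: FactGroup_def RCOSETS_def)
  have "coset_map G H T \<in> hom (G Mod lker) (H Mod rker)"
  proof (rule homI)
    show "coset_map G H T K \<in> carrier (H Mod rker)" if "K \<in> carrier (G Mod lker)" for K
      using dom[OF that] coset_map_eq ran by auto
    fix K K' assume "K \<in> carrier (G Mod lker)" "K' \<in> carrier (G Mod lker)"
    then obtain x y x' y' where T: "T x y" "T x' y'"
      and K: "K = lker #>\<^bsub>G\<^esub> x" "K' = lker #>\<^bsub>G\<^esub> x'"
      using dom by metis
    then show "coset_map G H T (K \<otimes>\<^bsub>G Mod lker\<^esub> K') =
        coset_map G H T K \<otimes>\<^bsub>H Mod rker\<^esub> coset_map G H T K'"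
      using coset_map_eq[OF mult[OF T]] coset_map_eq[OF T(1)] coset_map_eq[OF T(2)]
        left_carrier right_carrier
      by (simp add: L.rcos_sum R.rcos_sum)
  qed
  moreover have "inj_on (coset_map G H T) (carrier (G Mod lker))"
  proof (rule inj_onI)
    fix K K' assume "K \<in> carrier (G Mod lker)" "K' \<in> carrier (G Mod lker)"
      and eq: "coset_map G H T K = coset_map G H T K'"
    then obtain x y x' y' where T: "T x y" "T x' y'"
      and K: "K = lker #>\<^bsub>G\<^esub> x" "K' = lker #>\<^bsub>G\<^esub> x'"
      using dom by metis
    \<comment> \<open>Equal images make \<open>y\<close> a common partner of \<open>x\<close> and
      \<open>x'\<close>. The map of the swapped relation sends the coset of \<open>y\<close> to the
      cosets of both, so these are equal.\<close>
    have "T x' y"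
      using eq coset_map_iff[OF left_carrier[OF T(2)] right_carrier[OF T(1)]]
      by (simp add: K coset_map_eq[OF T(1)])
    from swap.coset_map_eq[OF this] show "K = K'"
      using swap.coset_map_eq[OF T(1)] by (simp add: K)
  qed
  moreover have "coset_map G H T ` carrier (G Mod lker) = carrier (H Mod rker)"
  proof (intro equalityI subsetI)
    fix K assume "K \<in> carrier (H Mod rker)"
    then obtain y where y: "y \<in> carrier H" "K = rker #>\<^bsub>H\<^esub> y"
      by (auto simp: FactGroup_def RCOSETS_def)
    then obtain x where x: "T x y" using right_total by blast
    have "lker #>\<^bsub>G\<^esub> x \<in> carrier (G Mod lker)"
      using left_carrier[OF x] by (auto simp: FactGroup_def RCOSETS_def)
    then show "K \<in> coset_map G H T ` carrier (G Mod lker)"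
      using coset_map_eq[OF x] y by (metis imageI)
  qed (use dom coset_map_eq ran in force)
  ultimately show ?thesis by (simp add: iso_def bij_betw_def)
qed

lemma coset_map_extensional: "coset_map G H T \<in> extensional (carrier (G Mod lker))"
  by (simp add: coset_map_def)

end

section \<open>From an isomorphism of quotients back to a Goursat relation\<close>

definition coset_rel ::
  "('a, 'm) monoid_scheme \<Rightarrow> 'a set \<Rightarrow> ('b, 'n) monoid_scheme \<Rightarrow> 'b set \<Rightarrow> ('a set \<Rightarrow> 'b set) \<Rightarrow>
    'a \<Rightarrow> 'b \<Rightarrow> bool"
  where "coset_rel G C H B \<phi> x y \<longleftrightarrow>
    x \<in> carrier G \<and> y \<in> carrier H \<and> \<phi> (C #>\<^bsub>G\<^esub> x) = B #>\<^bsub>H\<^esub> y"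

locale coset_iso = C: normal C G + B: normal B H
  for C and G :: "('a, 'm) monoid_scheme" and B and H :: "('b, 'n) monoid_scheme" +
  fixes \<phi>
  assumes iso: "\<phi> \<in> iso (G Mod C) (H Mod B)"
    and ext: "\<phi> \<in> extensional (carrier (G Mod C))"
begin

lemma mod_carrier: "K \<in> carrier (G Mod C) \<longleftrightarrow> (\<exists>x\<in>carrier G. K = C #>\<^bsub>G\<^esub> x)"
  by (auto simp: FactGroup_def RCOSETS_def)

lemma mod_carrier': "K \<in> carrier (H Mod B) \<longleftrightarrow> (\<exists>x\<in>carrier H. K = B #>\<^bsub>H\<^esub> x)"
  by (auto simp: FactGroup_def RCOSETS_def)

lemma map_one: "\<phi> (C #>\<^bsub>G\<^esub> \<one>\<^bsub>G\<^esub>) = B #>\<^bsub>H\<^esub> \<one>\<^bsub>H\<^esub>"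
  using hom_one[of \<phi> "G Mod C" "H Mod B"] iso C.factorgroup_is_group B.factorgroup_is_group
    C.subset B.subset
  by (simp add: iso_def)

text \<open>The relation is the preimage of the graph of \<open>\<phi>\<close> under the two
  quotient maps. Closure comes from the homomorphism law, left totality from the values of
  \<open>\<phi>\<close> being cosets, right totality from surjectivity.\<close>

lemma goursat: "goursat_relation G H (coset_rel G C H B \<phi>)"
proof unfold_locales
  have hom: "\<phi> \<in> hom (G Mod C) (H Mod B)" using iso by (simp add: iso_def)
  fix x y assume xy: "coset_rel G C H B \<phi> x y"
  show "x \<in> carrier G" "y \<in> carrier H" using xy by (auto simp: coset_rel_def)
  have mult: "\<phi> (C #>\<^bsub>G\<^esub> (x \<otimes>\<^bsub>G\<^esub> x')) = \<phi> (C #>\<^bsub>G\<^esub> x) <#>\<^bsub>H\<^esub> \<phi> (C #>\<^bsub>G\<^esub> x')"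
    if "x \<in> carrier G" "x' \<in> carrier G" for x x'
    using hom_mult[OF hom, of "C #>\<^bsub>G\<^esub> x" "C #>\<^bsub>G\<^esub> x'"] that
    by (auto simp: mod_carrier C.rcos_sum)
  show "coset_rel G C H B \<phi> (x \<otimes>\<^bsub>G\<^esub> x') (y \<otimes>\<^bsub>H\<^esub> y')" if "coset_rel G C H B \<phi> x' y'" for x' y'
    using xy that by (simp add: coset_rel_def mult B.rcos_sum)
  have "\<phi> (inv\<^bsub>G Mod C\<^esub> (C #>\<^bsub>G\<^esub> x)) = inv\<^bsub>H Mod B\<^esub> (\<phi> (C #>\<^bsub>G\<^esub> x))"
    using group_hom.hom_inv[of "G Mod C" "H Mod B" \<phi> "C #>\<^bsub>G\<^esub> x"] hom xy
      C.factorgroup_is_group B.factorgroup_is_group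
    by (auto simp: mod_carrier coset_rel_def group_hom_def group_hom_axioms_def)
  moreover have "inv\<^bsub>G Mod C\<^esub> (C #>\<^bsub>G\<^esub> x) = C #>\<^bsub>G\<^esub> inv\<^bsub>G\<^esub> x"
    using xy C.inv_FactGroup[of "C #>\<^bsub>G\<^esub> x"] C.rcos_inv[of x]
    by (auto simp: coset_rel_def mod_carrier)
  moreover have "inv\<^bsub>H Mod B\<^esub> (B #>\<^bsub>H\<^esub> y) = B #>\<^bsub>H\<^esub> inv\<^bsub>H\<^esub> y"
    using xy B.inv_FactGroup[of "B #>\<^bsub>H\<^esub> y"] B.rcos_inv[of y]
    by (auto simp: coset_rel_def mod_carrier')
  ultimately show "coset_rel G C H B \<phi> (inv\<^bsub>G\<^esub> x) (inv\<^bsub>H\<^esub> y)"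
    using xy by (simp add: coset_rel_def)
next
  fix x assume x: "x \<in> carrier G"
  then have "\<phi> (C #>\<^bsub>G\<^esub> x) \<in> carrier (H Mod B)"
    using iso mod_carrier by (intro hom_in_carrier[of \<phi> "G Mod C"]) (auto simp: iso_def)
  then show "\<exists>y. coset_rel G C H B \<phi> x y" using x by (auto simp: coset_rel_def mod_carrier')
next
  fix y assume y: "y \<in> carrier H"
  then have "B #>\<^bsub>H\<^esub> y \<in> \<phi> ` carrier (G Mod C)"
    using iso by (auto simp: iso_def bij_betw_def mod_carrier')
  then show "\<exists>x. coset_rel G C H B \<phi> x y" using y by (auto simp: coset_rel_def mod_carrier)
qed

lemma rker: "{y. coset_rel G C H B \<phi> \<one>\<^bsub>G\<^esub> y} = B"
  using map_one B.subset B.coset_join1[of B] B.coset_join2[of _ B] B.subgroup_axioms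
  by (auto simp: coset_rel_def)

text \<open>Injectivity of \<open>\<phi>\<close> enters here: only the trivial coset of
  \<open>C\<close> is sent to the trivial coset of \<open>B\<close>.\<close>

lemma lker: "{x. coset_rel G C H B \<phi> x \<one>\<^bsub>H\<^esub>} = C"
proof -
  have inj: "inj_on \<phi> (carrier (G Mod C))" using iso by (simp add: iso_def bij_betw_def)
  have "coset_rel G C H B \<phi> x \<one>\<^bsub>H\<^esub> \<longleftrightarrow> x \<in> carrier G \<and> C #>\<^bsub>G\<^esub> x = C #>\<^bsub>G\<^esub> \<one>\<^bsub>G\<^esub>" for x
    using map_one inj_onD[OF inj, of "C #>\<^bsub>G\<^esub> x" "C #>\<^bsub>G\<^esub> \<one>\<^bsub>G\<^esub>"]
    by (auto simp: coset_rel_def mod_carrier)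
  then show ?thesis
    using C.subset C.coset_join1[of C] C.coset_join2[of _ C] C.subgroup_axioms by auto
qed

text \<open>On the quotient, both functions send the coset of \<open>x\<close> to the coset of any
  partner of \<open>x\<close>; outside it, \<open>ext\<close> fixes the value.\<close>

lemma coset_map_rel: "coset_map G H (coset_rel G C H B \<phi>) = \<phi>"
proof (rule extensionalityI)
  interpret goursat_relation G H "coset_rel G C H B \<phi>" by (rule goursat)
  show "coset_map G H (coset_rel G C H B \<phi>) \<in> extensional (carrier (G Mod C))"
    using coset_map_extensional by (simp add: lker)
  show "\<phi> \<in> extensional (carrier (G Mod C))" by (rule ext)
  fix K assume "K \<in> carrier (G Mod C)"
  then obtain x where x: "x \<in> carrier G" "K = C #>\<^bsub>G\<^esub> x" by (auto simp: mod_carrier)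
  then obtain y where y: "coset_rel G C H B \<phi> x y" using left_total by blast
  then show "coset_map G H (coset_rel G C H B \<phi>) K = \<phi> K"
    using coset_map_eq[OF y, unfolded lker rker] x by (simp add: coset_rel_def)
qed

end

lemma (in group) eq_if_div_one:
  assumes "x \<in> carrier G" "y \<in> carrier G" "x \<otimes> inv y = \<one>" shows "x = y"
  using assms inv_equality[of x "inv y"] by simp

section \<open>Two-factor injective subdirect products as ternary relations\<close>

text \<open>With the coordinates as separate arguments, a cyclic shift of the indices is a
  permutation of arguments, so one index can stand for all three. \<open>inj1\<close> to
  \<open>inj3\<close> express injectivity of the maps deleting a coordinate by trivial
  kernels.\<close>

locale injective_triple = G1: group G1 + G2: group G2 + G3: group G3
  for G1 :: "('a, 'm) monoid_scheme" and G2 :: "('b, 'n) monoid_scheme"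
    and G3 :: "('c, 'p) monoid_scheme" +
  fixes R :: "'a \<Rightarrow> 'b \<Rightarrow> 'c \<Rightarrow> bool"
  assumes carrier1: "R a b c \<Longrightarrow> a \<in> carrier G1"
    and carrier2: "R a b c \<Longrightarrow> b \<in> carrier G2"
    and carrier3: "R a b c \<Longrightarrow> c \<in> carrier G3"
    and mult: "R a b c \<Longrightarrow> R a' b' c' \<Longrightarrow>
      R (a \<otimes>\<^bsub>G1\<^esub> a') (b \<otimes>\<^bsub>G2\<^esub> b') (c \<otimes>\<^bsub>G3\<^esub> c')"
    and inverse: "R a b c \<Longrightarrow> R (inv\<^bsub>G1\<^esub> a) (inv\<^bsub>G2\<^esub> b) (inv\<^bsub>G3\<^esub> c)"
    and total1: "a \<in> carrier G1 \<Longrightarrow> \<exists>b c. R a b c"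
    and total2: "b \<in> carrier G2 \<Longrightarrow> \<exists>a c. R a b c"
    and total3: "c \<in> carrier G3 \<Longrightarrow> \<exists>a b. R a b c"
    and inj1: "R a \<one>\<^bsub>G2\<^esub> \<one>\<^bsub>G3\<^esub> \<Longrightarrow> a = \<one>\<^bsub>G1\<^esub>"
    and inj2: "R \<one>\<^bsub>G1\<^esub> b \<one>\<^bsub>G3\<^esub> \<Longrightarrow> b = \<one>\<^bsub>G2\<^esub>"
    and inj3: "R \<one>\<^bsub>G1\<^esub> \<one>\<^bsub>G2\<^esub> c \<Longrightarrow> c = \<one>\<^bsub>G3\<^esub>"
begin

lemma rotate: "injective_triple G2 G3 G1 (\<lambda>b c a. R a b c)"
  by unfold_locales
    (blast intro: carrier1 carrier2 carrier3 mult inverse inj1 inj2 inj3 dest: total1 total2 total3)+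

lemma div:
  assumes "R a b c" "R a' b' c'"
  shows "R (a \<otimes>\<^bsub>G1\<^esub> inv\<^bsub>G1\<^esub> a') (b \<otimes>\<^bsub>G2\<^esub> inv\<^bsub>G2\<^esub> b') (c \<otimes>\<^bsub>G3\<^esub> inv\<^bsub>G3\<^esub> c')"
  using assms by (intro mult inverse)

text \<open>Degeneracy at the first coordinate: \<open>\<pi>\<^sub>1(H\<^sub>3) \<inter>
  \<pi>\<^sub>1(H\<^sub>2) = 1\<close>.\<close>

definition degenerate1 :: bool where
  "degenerate1 \<longleftrightarrow> (\<forall>a b c. R a b \<one>\<^bsub>G3\<^esub> \<longrightarrow> R a \<one>\<^bsub>G2\<^esub> c \<longrightarrow> a = \<one>\<^bsub>G1\<^esub>)"

text \<open>Dividing \<open>(a, b, 1)\<close> by \<open>(1, b, c)\<close> cancels the middle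
  coordinate, so \<open>a\<close> lies in the trivial intersection at the first coordinate; then
  \<open>inj2\<close> forces \<open>b\<close> to be trivial. This is the passage from some index to
  every index in the notion of degeneracy.\<close>

lemma degenerate1_rotate:
  assumes degenerate1
  shows "injective_triple.degenerate1 G2 G3 G1 (\<lambda>b c a. R a b c)"
proof -
  interpret rot: injective_triple G2 G3 G1 "\<lambda>b c a. R a b c" by (rule rotate)
  show ?thesis unfolding rot.degenerate1_def
  proof (intro allI impI)
    fix a b c assume bc: "R \<one>\<^bsub>G1\<^esub> b c" and ab: "R a b \<one>\<^bsub>G3\<^esub>"
    have "R a \<one>\<^bsub>G2\<^esub> (inv\<^bsub>G3\<^esub> c)"
      using div[OF ab bc] carrier1[OF ab] carrier2[OF ab] carrier3[OF bc] by simp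
    then have "a = \<one>\<^bsub>G1\<^esub>" using assms ab by (auto simp: degenerate1_def)
    then show "b = \<one>\<^bsub>G2\<^esub>" using ab inj2 by simp
  qed
qed

lemma goursat: "goursat_relation G1 G2 (\<lambda>a b. \<exists>c. R a b c)"
  by unfold_locales (blast intro: carrier1 carrier2 mult inverse dest: total1 total2)+

end

locale degenerate_triple = injective_triple +
  assumes deg: "R a b \<one>\<^bsub>G3\<^esub> \<Longrightarrow> R a \<one>\<^bsub>G2\<^esub> c \<Longrightarrow> a = \<one>\<^bsub>G1\<^esub>"
begin

lemma rotate_degenerate: "degenerate_triple G2 G3 G1 (\<lambda>b c a. R a b c)"
proof -
  interpret rot: injective_triple G2 G3 G1 "\<lambda>b c a. R a b c" by (rule rotate)
  have degenerate1 unfolding degenerate1_def using deg by blast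
  then have rot.degenerate1 by (rule degenerate1_rotate)
  then show ?thesis by unfold_locales (auto simp: rot.degenerate1_def)
qed

text \<open>Conditions 1 to 5 at the first index; rotation gives the others. \<open>?C\<close> and
  \<open>?B'\<close> are the kernels of the projection to coordinates 1 and 2, while
  \<open>?B\<close> is the right kernel of the projection to coordinates 3 and 1.\<close>

lemma local_conditions:
  "local_conditions G1 {a. \<exists>b. R a b \<one>\<^bsub>G3\<^esub>} {a. \<exists>c. R a \<one>\<^bsub>G2\<^esub> c}
    G2 {b. \<exists>c. R \<one>\<^bsub>G1\<^esub> b c} {b. \<exists>a. R a b \<one>\<^bsub>G3\<^esub>} (coset_map G1 G2 (\<lambda>a b. \<exists>c. R a b c))"
  (is "local_conditions G1 ?B ?C G2 ?B' ?C' ?\<phi>")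
proof -
  interpret T: goursat_relation G1 G2 "\<lambda>a b. \<exists>c. R a b c" by (rule goursat)
  interpret rot: degenerate_triple G2 G3 G1 "\<lambda>b c a. R a b c" by (rule rotate_degenerate)
  interpret rot2: degenerate_triple G3 G1 G2 "\<lambda>c a b. R a b c" by (rule rot.rotate_degenerate)
  have R1: "R \<one>\<^bsub>G1\<^esub> \<one>\<^bsub>G2\<^esub> \<one>\<^bsub>G3\<^esub>"
    using T.one inj3 by blast
  have "?B \<lhd> G1" using goursat_relation.rker_normal[OF rot2.goursat] by simp
  moreover have "?C \<lhd> G1" by (rule T.lker_normal)
  moreover have "?B \<inter> ?C = {\<one>\<^bsub>G1\<^esub>}" using deg R1 by blast
  moreover have "b \<otimes>\<^bsub>G1\<^esub> c = c \<otimes>\<^bsub>G1\<^esub> b" if b: "b \<in> ?B" and c: "c \<in> ?C" for b c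
  proof -
    obtain y z where y: "R b y \<one>\<^bsub>G3\<^esub>" and z: "R c \<one>\<^bsub>G2\<^esub> z" using b c by blast
    \<comment> \<open>The triples \<open>(b, y, 1)\<close> and \<open>(c, 1, z)\<close> have units
      in complementary places, so their products in either order end in \<open>y\<close> and
      \<open>z\<close>; injectivity after deleting the first coordinate makes the first entries
      agree.\<close>
    have "R (b \<otimes>\<^bsub>G1\<^esub> c) y z" "R (c \<otimes>\<^bsub>G1\<^esub> b) y z"
      using mult[OF y z] mult[OF z y] carrier2[OF y] carrier3[OF z] by simp_all
    from div[OF this] have "b \<otimes>\<^bsub>G1\<^esub> c \<otimes>\<^bsub>G1\<^esub> inv\<^bsub>G1\<^esub> (c \<otimes>\<^bsub>G1\<^esub> b) = \<one>\<^bsub>G1\<^esub>"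
      using carrier2[OF y] carrier3[OF z] by (intro inj1) simp
    then show ?thesis using carrier1[OF y] carrier1[OF z] by (metis G1.eq_if_div_one G1.m_closed)
  qed
  moreover have "?\<phi> \<in> iso (G1 Mod ?C) (G2 Mod ?B')" by (rule T.coset_map_iso)
  moreover have "?\<phi> \<in> extensional (carrier (G1 Mod ?C))" by (rule T.coset_map_extensional)
  \<comment> \<open>Condition 5: a triple \<open>(b, y, 1)\<close> puts \<open>b\<close> into
    \<open>?B\<close> and \<open>y\<close> into \<open>?C'\<close> at once. The remaining factors,
    from \<open>?C\<close> and \<open>?B'\<close>, are related to units.\<close>
  moreover have "?\<phi> ` ((\<lambda>x. ?C #>\<^bsub>G1\<^esub> x) ` (?B <#>\<^bsub>G1\<^esub> ?C)) = (\<lambda>y. ?B' #>\<^bsub>G2\<^esub> y) ` (?C' <#>\<^bsub>G2\<^esub> ?B')"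
  proof (intro equalityI subsetI)
    fix K assume "K \<in> ?\<phi> ` ((\<lambda>x. ?C #>\<^bsub>G1\<^esub> x) ` (?B <#>\<^bsub>G1\<^esub> ?C))"
    then obtain b y c z where b: "R b y \<one>\<^bsub>G3\<^esub>" and c: "R c \<one>\<^bsub>G2\<^esub> z"
      and K: "K = ?\<phi> (?C #>\<^bsub>G1\<^esub> (b \<otimes>\<^bsub>G1\<^esub> c))"
      by (auto simp: set_mult_def)
    have "K = ?B' #>\<^bsub>G2\<^esub> (y \<otimes>\<^bsub>G2\<^esub> \<one>\<^bsub>G2\<^esub>)"
      unfolding K using mult[OF b c] by (intro T.coset_map_eq) blast
    then show "K \<in> (\<lambda>y. ?B' #>\<^bsub>G2\<^esub> y) ` (?C' <#>\<^bsub>G2\<^esub> ?B')"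
      using b R1 by (force simp: set_mult_def)
  next
    fix K assume "K \<in> (\<lambda>y. ?B' #>\<^bsub>G2\<^esub> y) ` (?C' <#>\<^bsub>G2\<^esub> ?B')"
    then obtain a y b z where y: "R a y \<one>\<^bsub>G3\<^esub>" and b: "R \<one>\<^bsub>G1\<^esub> b z"
      and K: "K = ?B' #>\<^bsub>G2\<^esub> (y \<otimes>\<^bsub>G2\<^esub> b)"
      by (auto simp: set_mult_def)
    have "?\<phi> (?C #>\<^bsub>G1\<^esub> (a \<otimes>\<^bsub>G1\<^esub> \<one>\<^bsub>G1\<^esub>)) = K"
      unfolding K using mult[OF y b] by (intro T.coset_map_eq) blast
    then show "K \<in> ?\<phi> ` ((\<lambda>x. ?C #>\<^bsub>G1\<^esub> x) ` (?B <#>\<^bsub>G1\<^esub> ?C))"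
      using y R1 by (force simp: set_mult_def)
  qed
  ultimately show ?thesis unfolding local_conditions_def by blast
qed

text \<open>The pairwise projections carry all the information in \<open>R\<close>. Degeneracy is
  applied at the third coordinate, reached by two rotations.\<close>

lemma pairs_determine:
  assumes ab: "R a b z" and bc: "R x b c" and ca: "R a y c"
  shows "R a b c"
proof -
  interpret rot: degenerate_triple G2 G3 G1 "\<lambda>b c a. R a b c" by (rule rotate_degenerate)
  interpret rot2: degenerate_triple G3 G1 G2 "\<lambda>c a b. R a b c" by (rule rot.rotate_degenerate)
  have "R (x \<otimes>\<^bsub>G1\<^esub> inv\<^bsub>G1\<^esub> a) \<one>\<^bsub>G2\<^esub> (c \<otimes>\<^bsub>G3\<^esub> inv\<^bsub>G3\<^esub> z)"
    using div[OF bc ab] carrier2[OF ab] by simp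
  moreover have "R \<one>\<^bsub>G1\<^esub> (y \<otimes>\<^bsub>G2\<^esub> inv\<^bsub>G2\<^esub> b) (c \<otimes>\<^bsub>G3\<^esub> inv\<^bsub>G3\<^esub> z)"
    using div[OF ca ab] carrier1[OF ab] by simp
  ultimately have "c \<otimes>\<^bsub>G3\<^esub> inv\<^bsub>G3\<^esub> z = \<one>\<^bsub>G3\<^esub>" by (rule rot2.deg)
  then have "c = z" using carrier3[OF ca] carrier3[OF ab] by (metis G3.eq_if_div_one)
  then show ?thesis using ab by simp
qed

end

section \<open>Gluing three Goursat relations\<close>

text \<open>The left kernel of the relation at index \<open>i\<close> plays the role of
  \<open>C\<^sub>i\<close>, its right kernel that of \<open>B\<^sub>i\<^sub>+\<^sub>1\<close>. The
  \<open>trivial\<close> assumptions are condition 2, the \<open>transfer\<close> ones come from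
  condition 5, and \<open>cocycle\<close> comes from condition 6; its defect lies in
  \<open>C\<^sub>1\<close> alone because a factor from \<open>B\<^sub>1\<close> can be divided out
  inside \<open>T3\<close>.\<close>

locale gluing = T1: goursat_relation G1 G2 T1 + T2: goursat_relation G2 G3 T2 +
    T3: goursat_relation G3 G1 T3
  for G1 :: "('a, 'm) monoid_scheme" and G2 :: "('b, 'n) monoid_scheme"
    and G3 :: "('c, 'p) monoid_scheme" and T1 T2 T3 +
  assumes trivial1: "T1 a \<one>\<^bsub>G2\<^esub> \<Longrightarrow> T3 \<one>\<^bsub>G3\<^esub> a \<Longrightarrow> a = \<one>\<^bsub>G1\<^esub>"
    and trivial2: "T2 b \<one>\<^bsub>G3\<^esub> \<Longrightarrow> T1 \<one>\<^bsub>G1\<^esub> b \<Longrightarrow> b = \<one>\<^bsub>G2\<^esub>"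
    and trivial3: "T3 c \<one>\<^bsub>G1\<^esub> \<Longrightarrow> T2 \<one>\<^bsub>G2\<^esub> c \<Longrightarrow> c = \<one>\<^bsub>G3\<^esub>"
    and transfer2: "T3 c \<one>\<^bsub>G1\<^esub> \<Longrightarrow> \<exists>b. T1 \<one>\<^bsub>G1\<^esub> b \<and> T2 b c"
    and transfer3: "T1 a \<one>\<^bsub>G2\<^esub> \<Longrightarrow> \<exists>c. T2 \<one>\<^bsub>G2\<^esub> c \<and> T3 c a"
    and cocycle: "T1 x y \<Longrightarrow> T2 y z \<Longrightarrow> T3 z x' \<Longrightarrow> \<exists>c. T1 c \<one>\<^bsub>G2\<^esub> \<and> T3 z (c \<otimes>\<^bsub>G1\<^esub> x)"
begin

definition R where "R a b c \<longleftrightarrow> T1 a b \<and> T2 b c \<and> T3 c a"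

text \<open>Gluing does not shrink the three relations. Each of the pair lemmas corrects the
  coordinate that is not prescribed, here the third.\<close>

lemma pair1: "(\<exists>z. R x y z) \<longleftrightarrow> T1 x y"
proof
  assume x: "T1 x y"
  obtain z x' where z: "T2 y z" "T3 z x'"
    using T2.left_total T3.left_total T1.right_carrier[OF x] T2.right_carrier by metis
  from cocycle[OF x z] obtain c where c: "T1 c \<one>\<^bsub>G2\<^esub>" "T3 z (c \<otimes>\<^bsub>G1\<^esub> x)" by blast
  \<comment> \<open>The defect \<open>c\<close> is shifted to the third coordinate: \<open>d\<close>
    lies in the right kernel of \<open>T2\<close>, so dividing \<open>z\<close> by it keeps
    \<open>y\<close> as a partner, while through \<open>T3\<close> it cancels
    \<open>c\<close>.\<close>
  from transfer3[OF c(1)] obtain d where d: "T2 \<one>\<^bsub>G2\<^esub> d" "T3 d c" by blast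
  have "T2 y (inv\<^bsub>G3\<^esub> d \<otimes>\<^bsub>G3\<^esub> z)"
    using T2.mult[OF T2.inverse[OF d(1)] z(1)] T2.left_carrier[OF z(1)] by simp
  moreover have "T3 (inv\<^bsub>G3\<^esub> d \<otimes>\<^bsub>G3\<^esub> z) x"
    using T3.mult[OF T3.inverse[OF d(2)] c(2)] T1.left_carrier[OF x] T1.left_carrier[OF c(1)]
    by (simp flip: T1.G.m_assoc)
  ultimately show "\<exists>z. R x y z" using x by (auto simp: R_def)
qed (auto simp: R_def)

lemma pair2: "(\<exists>x. R x y z) \<longleftrightarrow> T2 y z"
proof
  assume z: "T2 y z"
  obtain x x' where x: "T1 x y" "T3 z x'"
    using T1.right_total T3.left_total T2.left_carrier[OF z] T2.right_carrier[OF z] by metis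
  from cocycle[OF x(1) z x(2)] obtain c where c: "T1 c \<one>\<^bsub>G2\<^esub>" "T3 z (c \<otimes>\<^bsub>G1\<^esub> x)" by blast
  \<comment> \<open>The first coordinate is free here, so it absorbs the defect directly: a left
    kernel factor does not change the partner \<open>y\<close>.\<close>
  have "T1 (c \<otimes>\<^bsub>G1\<^esub> x) y"
    using T1.mult[OF c(1) x(1)] T1.right_carrier[OF x(1)] by simp
  then show "\<exists>x. R x y z" using c z by (auto simp: R_def)
qed (auto simp: R_def)

lemma pair3: "(\<exists>y. R x y z) \<longleftrightarrow> T3 z x"
proof
  assume z: "T3 z x"
  obtain y where y: "T1 x y" using T1.left_total T3.right_carrier[OF z] by blast
  then obtain z' where R: "R x y z'" using pair1 by blast
  then have z': "T2 y z'" "T3 z' x" by (simp_all add: R_def)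
  have carr: "z \<in> carrier G3" "z' \<in> carrier G3"
    using z z' by (auto intro: T3.left_carrier)
  \<comment> \<open>Both \<open>z\<close> and \<open>z'\<close> are related to \<open>x\<close> by
    \<open>T3\<close>, so their quotient lies in \<open>C\<^sub>3\<close>. The element
    \<open>b\<close> of \<open>B\<^sub>2\<close> corrects \<open>y\<close> accordingly without
    disturbing its relation to \<open>x\<close>.\<close>
  from transfer2[OF T3.left_div[OF z'(2) z]]
  obtain b where b: "T1 \<one>\<^bsub>G1\<^esub> b" "T2 b (z \<otimes>\<^bsub>G3\<^esub> inv\<^bsub>G3\<^esub> z')" by blast
  have "T1 x (b \<otimes>\<^bsub>G2\<^esub> y)" using T1.mult[OF b(1) y] T1.left_carrier[OF y] by simp
  moreover have "T2 (b \<otimes>\<^bsub>G2\<^esub> y) z"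
    using T2.mult[OF b(2) z'(1)] carr by (simp add: T2.H.m_assoc)
  ultimately show "\<exists>y. R x y z" using z by (auto simp: R_def)
qed (auto simp: R_def)

text \<open>Totality comes from the pair lemmas; injectivity and degeneracy are both consequences of
  the intersections in \<open>trivial1\<close> to \<open>trivial3\<close>.\<close>

lemma degenerate_triple_R: "degenerate_triple G1 G2 G3 R"
proof unfold_locales
  fix a b c assume R: "R a b c"
  then show "a \<in> carrier G1" "b \<in> carrier G2" "c \<in> carrier G3"
    by (auto simp: R_def intro: T1.left_carrier T2.left_carrier T3.left_carrier)
  show "R (inv\<^bsub>G1\<^esub> a) (inv\<^bsub>G2\<^esub> b) (inv\<^bsub>G3\<^esub> c)"
    using R by (simp add: R_def T1.inverse T2.inverse T3.inverse)
  show "R (a \<otimes>\<^bsub>G1\<^esub> a') (b \<otimes>\<^bsub>G2\<^esub> b') (c \<otimes>\<^bsub>G3\<^esub> c')" if "R a' b' c'" for a' b' c'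
    using R that by (simp add: R_def T1.mult T2.mult T3.mult)
next
  show "\<exists>b c. R a b c" if "a \<in> carrier G1" for a using T1.left_total[OF that] pair1 by blast
  show "\<exists>a c. R a b c" if "b \<in> carrier G2" for b using T1.right_total[OF that] pair1 by blast
  show "\<exists>a b. R a b c" if "c \<in> carrier G3" for c using T3.left_total[OF that] pair3 by blast
qed (auto simp: R_def intro: trivial1 trivial2 trivial3)

end

section \<open>The correspondence\<close>

lemma image_proj:
  "proj1 ` X = {a. \<exists>b c. (a, b, c) \<in> X}"
  "proj2 ` X = {b. \<exists>a c. (a, b, c) \<in> X}"
  "proj3 ` X = {c. \<exists>a b. (a, b, c) \<in> X}"
  by (force simp: proj1_def proj2_def proj3_def)+

lemma degenerate_iff:
  "degenerate G1 G2 G3 \<Delta> \<longleftrightarrow>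
    {a. \<exists>c. (a, \<one>\<^bsub>G2\<^esub>, c) \<in> \<Delta>} \<inter> {a. \<exists>b. (a, b, \<one>\<^bsub>G3\<^esub>) \<in> \<Delta>} = {a. (a, \<one>\<^bsub>G2\<^esub>, \<one>\<^bsub>G3\<^esub>) \<in> \<Delta>} \<or>
    {b. \<exists>a. (a, b, \<one>\<^bsub>G3\<^esub>) \<in> \<Delta>} \<inter> {b. \<exists>c. (\<one>\<^bsub>G1\<^esub>, b, c) \<in> \<Delta>} = {b. (\<one>\<^bsub>G1\<^esub>, b, \<one>\<^bsub>G3\<^esub>) \<in> \<Delta>} \<or>
    {c. \<exists>b. (\<one>\<^bsub>G1\<^esub>, b, c) \<in> \<Delta>} \<inter> {c. \<exists>a. (a, \<one>\<^bsub>G2\<^esub>, c) \<in> \<Delta>} = {c. (\<one>\<^bsub>G1\<^esub>, \<one>\<^bsub>G2\<^esub>, c) \<in> \<Delta>}"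
  unfolding degenerate_def Let_def image_proj kernel_def
  by (simp add: proj1_def proj2_def proj3_def del1_def del2_def del3_def)

text \<open>Here \<open>subdirect\<close>, \<open>two_factor_injective\<close> and
  \<open>degenerate\<close> are unfolded; later arguments about \<open>\<Delta>\<close> use the
  relational form.\<close>

lemma mem_deg_2fi_subdirect_iff:
  assumes "group G1" "group G2" "group G3"
  shows "\<Delta> \<in> deg_2fi_subdirect G1 G2 G3 \<longleftrightarrow>
    degenerate_triple G1 G2 G3 (\<lambda>a b c. (a, b, c) \<in> \<Delta>)"
proof -
  interpret G1: group G1 by fact
  interpret G2: group G2 by fact
  interpret G3: group G3 by fact
  interpret P: group "prod3 G1 G2 G3"
    unfolding prod3_def by (intro DirProd_group assms)
  have inv3: "inv\<^bsub>prod3 G1 G2 G3\<^esub> (a, b, c) = (inv\<^bsub>G1\<^esub> a, inv\<^bsub>G2\<^esub> b, inv\<^bsub>G3\<^esub> c)"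
    if "a \<in> carrier G1" "b \<in> carrier G2" "c \<in> carrier G3" for a b c
    using that assms by (simp add: prod3_def DirProd_group)
  show ?thesis
  proof
    assume "\<Delta> \<in> deg_2fi_subdirect G1 G2 G3"
    then have sub: "subgroup \<Delta> (prod3 G1 G2 G3)"
      and surj: "proj1 ` \<Delta> = carrier G1" "proj2 ` \<Delta> = carrier G2" "proj3 ` \<Delta> = carrier G3"
      and inj: "inj_on del1 \<Delta>" "inj_on del2 \<Delta>" "inj_on del3 \<Delta>"
      and deg: "degenerate G1 G2 G3 \<Delta>"
      by (auto simp: deg_2fi_subdirect_def subdirect_def two_factor_injective_def)
    interpret S: subgroup \<Delta> "prod3 G1 G2 G3" by (rule sub)
    have one: "(\<one>\<^bsub>G1\<^esub>, \<one>\<^bsub>G2\<^esub>, \<one>\<^bsub>G3\<^esub>) \<in> \<Delta>" using S.one_closed by (simp add: prod3_def)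
    interpret T: injective_triple G1 G2 G3 "\<lambda>a b c. (a, b, c) \<in> \<Delta>"
    proof unfold_locales
      fix a b c assume R: "(a, b, c) \<in> \<Delta>"
      show carr: "a \<in> carrier G1" "b \<in> carrier G2" "c \<in> carrier G3"
        using S.subset R by (auto simp: prod3_def)
      show "(inv\<^bsub>G1\<^esub> a, inv\<^bsub>G2\<^esub> b, inv\<^bsub>G3\<^esub> c) \<in> \<Delta>"
        using S.m_inv_closed[OF R] carr by (simp add: inv3)
      show "(a \<otimes>\<^bsub>G1\<^esub> a', b \<otimes>\<^bsub>G2\<^esub> b', c \<otimes>\<^bsub>G3\<^esub> c') \<in> \<Delta>" if "(a', b', c') \<in> \<Delta>" for a' b' c'
        using S.m_closed[OF R that] by (simp add: prod3_def)
    next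
      show "\<exists>b c. (a, b, c) \<in> \<Delta>" if "a \<in> carrier G1" for a using surj[unfolded image_proj] that by blast
      show "\<exists>a c. (a, b, c) \<in> \<Delta>" if "b \<in> carrier G2" for b using surj[unfolded image_proj] that by blast
      show "\<exists>a b. (a, b, c) \<in> \<Delta>" if "c \<in> carrier G3" for c using surj[unfolded image_proj] that by blast
      show "a = \<one>\<^bsub>G1\<^esub>" if "(a, \<one>\<^bsub>G2\<^esub>, \<one>\<^bsub>G3\<^esub>) \<in> \<Delta>" for a
        using inj_onD[OF inj(1) _ that one] by (simp add: del1_def)
      show "b = \<one>\<^bsub>G2\<^esub>" if "(\<one>\<^bsub>G1\<^esub>, b, \<one>\<^bsub>G3\<^esub>) \<in> \<Delta>" for b
        using inj_onD[OF inj(2) _ that one] by (simp add: del2_def)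
      show "c = \<one>\<^bsub>G3\<^esub>" if "(\<one>\<^bsub>G1\<^esub>, \<one>\<^bsub>G2\<^esub>, c) \<in> \<Delta>" for c
        using inj_onD[OF inj(3) _ that one] by (simp add: del3_def)
    qed
    interpret T': injective_triple G2 G3 G1 "\<lambda>b c a. (a, b, c) \<in> \<Delta>" by (rule T.rotate)
    interpret T'': injective_triple G3 G1 G2 "\<lambda>c a b. (a, b, c) \<in> \<Delta>" by (rule T'.rotate)
    from deg have "T.degenerate1 \<or> T'.degenerate1 \<or> T''.degenerate1"
      unfolding degenerate_iff T.degenerate1_def T'.degenerate1_def T''.degenerate1_def
      using T.inj1 T.inj2 T.inj3 by (elim disjE) blast+
    \<comment> \<open>Degeneracy moves forward along the cycle of indices, and the rotation of
      \<open>T''\<close> is \<open>T\<close> again.\<close>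
    then have "T.degenerate1"
      using T'.degenerate1_rotate T''.degenerate1_rotate by blast
    then show "degenerate_triple G1 G2 G3 (\<lambda>a b c. (a, b, c) \<in> \<Delta>)"
      by unfold_locales (auto simp: T.degenerate1_def)
  next
    assume "degenerate_triple G1 G2 G3 (\<lambda>a b c. (a, b, c) \<in> \<Delta>)"
    then interpret T: degenerate_triple G1 G2 G3 "\<lambda>a b c. (a, b, c) \<in> \<Delta>" .
    have one: "(\<one>\<^bsub>G1\<^esub>, \<one>\<^bsub>G2\<^esub>, \<one>\<^bsub>G3\<^esub>) \<in> \<Delta>"
      using goursat_relation.one[OF T.goursat] T.inj3 by blast
    have "subgroup \<Delta> (prod3 G1 G2 G3)"
    proof (rule P.subgroupI)
      show sub: "\<Delta> \<subseteq> carrier (prod3 G1 G2 G3)"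
        using T.carrier1 T.carrier2 T.carrier3 by (auto simp: prod3_def)
      show "\<Delta> \<noteq> {}" using one by auto
      show "inv\<^bsub>prod3 G1 G2 G3\<^esub> x \<in> \<Delta>" if "x \<in> \<Delta>" for x
        using that T.carrier1 T.carrier2 T.carrier3 T.inverse by (cases x) (auto simp: inv3)
      show "x \<otimes>\<^bsub>prod3 G1 G2 G3\<^esub> y \<in> \<Delta>" if "x \<in> \<Delta>" "y \<in> \<Delta>" for x y
        using that T.mult by (cases x; cases y) (auto simp: prod3_def)
    qed
    moreover have "proj1 ` \<Delta> = carrier G1"
      using T.total1 T.carrier1 by (auto simp: image_proj)
    moreover have "proj2 ` \<Delta> = carrier G2"
      using T.total2 T.carrier2 by (auto simp: image_proj)
    moreover have "proj3 ` \<Delta> = carrier G3"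
      using T.total3 T.carrier3 by (auto simp: image_proj)
    moreover have "inj_on del1 \<Delta>"
    proof (rule inj_onI, clarsimp simp: del1_def)
      fix a a' b c assume *: "(a, b, c) \<in> \<Delta>" "(a', b, c) \<in> \<Delta>"
      have "a \<otimes>\<^bsub>G1\<^esub> inv\<^bsub>G1\<^esub> a' = \<one>\<^bsub>G1\<^esub>"
        using T.div[OF *] T.carrier2[OF *(1)] T.carrier3[OF *(1)] by (intro T.inj1) simp
      then show "a = a'"
        using T.carrier1[OF *(1)] T.carrier1[OF *(2)] by (metis G1.eq_if_div_one)
    qed
    moreover have "inj_on del2 \<Delta>"
    proof (rule inj_onI, clarsimp simp: del2_def)
      fix a b b' c assume *: "(a, b, c) \<in> \<Delta>" "(a, b', c) \<in> \<Delta>"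
      have "b \<otimes>\<^bsub>G2\<^esub> inv\<^bsub>G2\<^esub> b' = \<one>\<^bsub>G2\<^esub>"
        using T.div[OF *] T.carrier1[OF *(1)] T.carrier3[OF *(1)] by (intro T.inj2) simp
      then show "b = b'"
        using T.carrier2[OF *(1)] T.carrier2[OF *(2)] by (metis G2.eq_if_div_one)
    qed
    moreover have "inj_on del3 \<Delta>"
    proof (rule inj_onI, clarsimp simp: del3_def)
      fix a b c c' assume *: "(a, b, c) \<in> \<Delta>" "(a, b, c') \<in> \<Delta>"
      have "c \<otimes>\<^bsub>G3\<^esub> inv\<^bsub>G3\<^esub> c' = \<one>\<^bsub>G3\<^esub>"
        using T.div[OF *] T.carrier1[OF *(1)] T.carrier2[OF *(1)] by (intro T.inj3) simp
      then show "c = c'"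
        using T.carrier3[OF *(1)] T.carrier3[OF *(2)] by (metis G3.eq_if_div_one)
    qed
    moreover have "degenerate G1 G2 G3 \<Delta>"
      unfolding degenerate_iff using one T.deg by (intro disjI1) blast
    ultimately show "\<Delta> \<in> deg_2fi_subdirect G1 G2 G3"
      by (simp add: deg_2fi_subdirect_def subdirect_def two_factor_injective_def)
  qed
qed

section \<open>The two maps between subdirect products and tuples\<close>

definition gluing_data_of ::
  "('a, 'm) monoid_scheme \<Rightarrow> ('b, 'n) monoid_scheme \<Rightarrow> ('c, 'p) monoid_scheme \<Rightarrow>
    ('a \<times> 'b \<times> 'c) set \<Rightarrow> ('a, 'b, 'c) gluing_data"
  where "gluing_data_of G1 G2 G3 \<Delta> =
    (proj1 ` H3 G3 \<Delta>, proj2 ` H1 G1 \<Delta>, proj3 ` H2 G2 \<Delta>,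
     proj1 ` H2 G2 \<Delta>, proj2 ` H3 G3 \<Delta>, proj3 ` H1 G1 \<Delta>,
     coset_map G1 G2 (\<lambda>a b. \<exists>c. (a, b, c) \<in> \<Delta>),
     coset_map G2 G3 (\<lambda>b c. \<exists>a. (a, b, c) \<in> \<Delta>),
     coset_map G3 G1 (\<lambda>c a. \<exists>b. (a, b, c) \<in> \<Delta>))"

fun glued ::
  "('a, 'm) monoid_scheme \<Rightarrow> ('b, 'n) monoid_scheme \<Rightarrow> ('c, 'p) monoid_scheme \<Rightarrow>
    ('a, 'b, 'c) gluing_data \<Rightarrow> ('a \<times> 'b \<times> 'c) set"
  where "glued G1 G2 G3 (B1, B2, B3, C1, C2, C3, \<phi>1, \<phi>2, \<phi>3) =
    {(g1, g2, g3). (g1, g2, g3) \<in> carrier (prod3 G1 G2 G3) \<and>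
      \<phi>1 (C1 #>\<^bsub>G1\<^esub> g1) = B2 #>\<^bsub>G2\<^esub> g2 \<and>
      \<phi>2 (C2 #>\<^bsub>G2\<^esub> g2) = B3 #>\<^bsub>G3\<^esub> g3 \<and>
      \<phi>3 (C3 #>\<^bsub>G3\<^esub> g3) = B1 #>\<^bsub>G1\<^esub> g1}"

lemma mem_glued:
  "(a, b, c) \<in> glued G1 G2 G3 (B1, B2, B3, C1, C2, C3, \<phi>1, \<phi>2, \<phi>3) \<longleftrightarrow>
    coset_rel G1 C1 G2 B2 \<phi>1 a b \<and> coset_rel G2 C2 G3 B3 \<phi>2 b c \<and> coset_rel G3 C3 G1 B1 \<phi>3 c a"
  by (auto simp: coset_rel_def prod3_def)

lemma proj_H:
  "proj1 ` H3 G3 \<Delta> = {a. \<exists>b. (a, b, \<one>\<^bsub>G3\<^esub>) \<in> \<Delta>}" "proj2 ` H1 G1 \<Delta> = {b. \<exists>c. (\<one>\<^bsub>G1\<^esub>, b, c) \<in> \<Delta>}"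
  "proj3 ` H2 G2 \<Delta> = {c. \<exists>a. (a, \<one>\<^bsub>G2\<^esub>, c) \<in> \<Delta>}" "proj1 ` H2 G2 \<Delta> = {a. \<exists>c. (a, \<one>\<^bsub>G2\<^esub>, c) \<in> \<Delta>}"
  "proj2 ` H3 G3 \<Delta> = {b. \<exists>a. (a, b, \<one>\<^bsub>G3\<^esub>) \<in> \<Delta>}" "proj3 ` H1 G1 \<Delta> = {c. \<exists>b. (\<one>\<^bsub>G1\<^esub>, b, c) \<in> \<Delta>}"
  by (force simp: proj1_def proj2_def proj3_def H1_def H2_def H3_def)+

lemma gluing_data_ofD:
  assumes "gluing_data_of G1 G2 G3 \<Delta> = (B1, B2, B3, C1, C2, C3, \<phi>1, \<phi>2, \<phi>3)"
  shows "B1 = {a. \<exists>b. (a, b, \<one>\<^bsub>G3\<^esub>) \<in> \<Delta>}" "B2 = {b. \<exists>c. (\<one>\<^bsub>G1\<^esub>, b, c) \<in> \<Delta>}"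
    "B3 = {c. \<exists>a. (a, \<one>\<^bsub>G2\<^esub>, c) \<in> \<Delta>}" "C1 = {a. \<exists>c. (a, \<one>\<^bsub>G2\<^esub>, c) \<in> \<Delta>}"
    "C2 = {b. \<exists>a. (a, b, \<one>\<^bsub>G3\<^esub>) \<in> \<Delta>}" "C3 = {c. \<exists>b. (\<one>\<^bsub>G1\<^esub>, b, c) \<in> \<Delta>}"
    "\<phi>1 = coset_map G1 G2 (\<lambda>a b. \<exists>c. (a, b, c) \<in> \<Delta>)"
    "\<phi>2 = coset_map G2 G3 (\<lambda>b c. \<exists>a. (a, b, c) \<in> \<Delta>)"
    "\<phi>3 = coset_map G3 G1 (\<lambda>c a. \<exists>b. (a, b, c) \<in> \<Delta>)"
  using assms unfolding gluing_data_of_def proj_H by simp_all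

lemma set_mult_memI: "h \<in> H \<Longrightarrow> k \<in> K \<Longrightarrow> h \<otimes>\<^bsub>G\<^esub> k \<in> H <#>\<^bsub>G\<^esub> K"
  by (auto simp: set_mult_def)

lemma r_coset_memI: "h \<in> H \<Longrightarrow> h \<otimes>\<^bsub>G\<^esub> x \<in> H #>\<^bsub>G\<^esub> x"
  by (auto simp: r_coset_def)

lemma local_conditions_coset_iso:
  "local_conditions G B C G' B' C' \<phi> \<Longrightarrow> B' \<lhd> G' \<Longrightarrow> coset_iso C G B' G' \<phi>"
  by (simp add: local_conditions_def coset_iso_def coset_iso_axioms_def)

text \<open>Condition 5 yields only a product \<open>b c\<close> related to \<open>c'\<close>. Its
  factor \<open>c\<close> from \<open>C\<close> is related to the unit and can be divided off,
  leaving \<open>b\<close>. This supplies the \<open>transfer\<close> assumptions of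
  \<open>gluing\<close>.\<close>

lemma local_conditions_transfer:
  assumes loc: "local_conditions G B C G' B' C' \<phi>" and B': "B' \<lhd> G'" and c': "c' \<in> C'"
    and C': "C' \<lhd> G'"
  shows "\<exists>b\<in>B. coset_rel G C G' B' \<phi> b c'"
proof -
  interpret coset_iso C G B' G' \<phi> using loc B' by (rule local_conditions_coset_iso)
  interpret T: goursat_relation G G' "coset_rel G C G' B' \<phi>" by (rule goursat)
  interpret N: normal B G using loc by (simp add: local_conditions_def)
  interpret C': normal C' G' by fact
  have "c' \<otimes>\<^bsub>G'\<^esub> \<one>\<^bsub>G'\<^esub> \<in> C' <#>\<^bsub>G'\<^esub> B'"
    using c' subgroup.one_closed[OF B.subgroup_axioms] by (rule set_mult_memI)
  then have "B' #>\<^bsub>G'\<^esub> c' \<in> (\<lambda>y. B' #>\<^bsub>G'\<^esub> y) ` (C' <#>\<^bsub>G'\<^esub> B')"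
    using c' C'.subset by force
  also have "\<dots> = \<phi> ` ((\<lambda>x. C #>\<^bsub>G\<^esub> x) ` (B <#>\<^bsub>G\<^esub> C))"
    using loc by (simp add: local_conditions_def)
  finally obtain b c where b: "b \<in> B" and c: "c \<in> C"
    and eq: "\<phi> (C #>\<^bsub>G\<^esub> (b \<otimes>\<^bsub>G\<^esub> c)) = B' #>\<^bsub>G'\<^esub> c'"
    by (auto simp: set_mult_def)
  have carr: "b \<in> carrier G" "c \<in> carrier G" "c' \<in> carrier G'"
    using b c c' N.subset C.subset C'.subset by auto
  have "coset_rel G C G' B' \<phi> (b \<otimes>\<^bsub>G\<^esub> c) c'" using carr eq by (simp add: coset_rel_def)
  moreover have "coset_rel G C G' B' \<phi> c \<one>\<^bsub>G'\<^esub>" using lker c by auto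
  ultimately have "coset_rel G C G' B' \<phi> (b \<otimes>\<^bsub>G\<^esub> c \<otimes>\<^bsub>G\<^esub> inv\<^bsub>G\<^esub> c) (c' \<otimes>\<^bsub>G'\<^esub> inv\<^bsub>G'\<^esub> \<one>\<^bsub>G'\<^esub>)"
    by (intro T.mult T.inverse)
  then show ?thesis using b carr by (auto simp: C.m_assoc)
qed

lemma gluing_data_of_mem:
  assumes "group G1" "group G2" "group G3" and \<Delta>: "\<Delta> \<in> deg_2fi_subdirect G1 G2 G3"
  shows "gluing_data_of G1 G2 G3 \<Delta> \<in> gluing_tuples G1 G2 G3"
proof -
  interpret T: degenerate_triple G1 G2 G3 "\<lambda>a b c. (a, b, c) \<in> \<Delta>"
    using assms by (simp add: mem_deg_2fi_subdirect_iff)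
  interpret T': degenerate_triple G2 G3 G1 "\<lambda>b c a. (a, b, c) \<in> \<Delta>" by (rule T.rotate_degenerate)
  interpret T'': degenerate_triple G3 G1 G2 "\<lambda>c a b. (a, b, c) \<in> \<Delta>" by (rule T'.rotate_degenerate)
  note loc = T.local_conditions T'.local_conditions T''.local_conditions
  have normal: "B \<lhd> G" "C \<lhd> G" if "local_conditions G B C G' B' C' \<phi>"
    for G :: "('x, 'y) monoid_scheme" and B C and G' :: "('z, 'w) monoid_scheme" and B' C' \<phi>
    using that by (simp_all add: local_conditions_def)
  note normals = normal[OF loc(1)] normal[OF loc(2)] normal[OF loc(3)]
  have "induced G3 C3 \<phi>3 (induced G2 C2 \<phi>2 (induced G1 C1 \<phi>1 ((B1 <#>\<^bsub>G1\<^esub> C1) #>\<^bsub>G1\<^esub> a))) =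
      (B1 <#>\<^bsub>G1\<^esub> C1) #>\<^bsub>G1\<^esub> a"
    if a: "a \<in> carrier G1" and eq: "gluing_data_of G1 G2 G3 \<Delta> = (B1, B2, B3, C1, C2, C3, \<phi>1, \<phi>2, \<phi>3)"
    for a B1 B2 B3 C1 C2 C3 \<phi>1 \<phi>2 \<phi>3
  proof -
    \<comment> \<open>Condition 6: one triple of \<open>\<Delta>\<close> over \<open>a\<close>
      traces the coset of \<open>a\<close> through the three induced maps by
      \<open>induced_coset\<close>, and the last step leads back to \<open>a\<close>.\<close>
    obtain b c where R: "(a, b, c) \<in> \<Delta>" using T.total1 a by blast
    have carr: "b \<in> carrier G2" "c \<in> carrier G3" using T.carrier2[OF R] T.carrier3[OF R] .
    note eqs [simp] = gluing_data_ofD[OF eq]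
    have "\<phi>1 (C1 #>\<^bsub>G1\<^esub> a) = B2 #>\<^bsub>G2\<^esub> b"
      using goursat_relation.coset_map_eq[OF T.goursat, where x = a and y = b] R by auto
    moreover have "\<phi>2 (C2 #>\<^bsub>G2\<^esub> b) = B3 #>\<^bsub>G3\<^esub> c"
      using goursat_relation.coset_map_eq[OF T'.goursat, where x = b and y = c] R by auto
    moreover have "\<phi>3 (C3 #>\<^bsub>G3\<^esub> c) = B1 #>\<^bsub>G1\<^esub> a"
      using goursat_relation.coset_map_eq[OF T''.goursat, where x = c and y = a] R by auto
    ultimately show ?thesis
      using induced_coset[OF assms(1,2) loc(1) normals(4,3) a carr(1)]
        induced_coset[OF assms(2,3) loc(2) normals(6,5) carr]
        induced_coset[OF assms(3,1) loc(3) normals(2,1) carr(2) a]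
      by simp
  qed
  then show ?thesis
    using loc by (auto simp: gluing_tuples_def gluing_data_of_def proj_H)
qed

text \<open>Identifying the kernels of the three relations as \<open>C\<^sub>i\<close> and
  \<open>B\<^sub>i\<^sub>+\<^sub>1\<close> turns the conditions on a tuple into statements about
  elements.\<close>

lemma gluing_of_tuple:
  assumes "group G1" "group G2" "group G3"
    and tuple: "(B1, B2, B3, C1, C2, C3, \<phi>1, \<phi>2, \<phi>3) \<in> gluing_tuples G1 G2 G3"
  shows "gluing G1 G2 G3 (coset_rel G1 C1 G2 B2 \<phi>1) (coset_rel G2 C2 G3 B3 \<phi>2)
    (coset_rel G3 C3 G1 B1 \<phi>3)"
proof -
  have loc: "local_conditions G1 B1 C1 G2 B2 C2 \<phi>1" "local_conditions G2 B2 C2 G3 B3 C3 \<phi>2"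
    "local_conditions G3 B3 C3 G1 B1 C1 \<phi>3"
    and coc: "\<And>g1. g1 \<in> carrier G1 \<Longrightarrow>
      induced G3 C3 \<phi>3 (induced G2 C2 \<phi>2 (induced G1 C1 \<phi>1 ((B1 <#>\<^bsub>G1\<^esub> C1) #>\<^bsub>G1\<^esub> g1)))
        = (B1 <#>\<^bsub>G1\<^esub> C1) #>\<^bsub>G1\<^esub> g1"
    using tuple by (auto simp: gluing_tuples_def)
  then have normals: "B1 \<lhd> G1" "C1 \<lhd> G1" "B2 \<lhd> G2" "C2 \<lhd> G2" "B3 \<lhd> G3" "C3 \<lhd> G3"
    and triv: "B1 \<inter> C1 = {\<one>\<^bsub>G1\<^esub>}" "B2 \<inter> C2 = {\<one>\<^bsub>G2\<^esub>}" "B3 \<inter> C3 = {\<one>\<^bsub>G3\<^esub>}"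
    by (auto simp: local_conditions_def)
  interpret I1: coset_iso C1 G1 B2 G2 \<phi>1 using loc(1) normals(3) by (rule local_conditions_coset_iso)
  interpret I2: coset_iso C2 G2 B3 G3 \<phi>2 using loc(2) normals(5) by (rule local_conditions_coset_iso)
  interpret I3: coset_iso C3 G3 B1 G1 \<phi>3 using loc(3) normals(1) by (rule local_conditions_coset_iso)
  interpret T1: goursat_relation G1 G2 "coset_rel G1 C1 G2 B2 \<phi>1" by (rule I1.goursat)
  interpret T2: goursat_relation G2 G3 "coset_rel G2 C2 G3 B3 \<phi>2" by (rule I2.goursat)
  interpret T3: goursat_relation G3 G1 "coset_rel G3 C3 G1 B1 \<phi>3" by (rule I3.goursat)
  show ?thesis
  proof unfold_locales
    show "a = \<one>\<^bsub>G1\<^esub>" if "coset_rel G1 C1 G2 B2 \<phi>1 a \<one>\<^bsub>G2\<^esub>" "coset_rel G3 C3 G1 B1 \<phi>3 \<one>\<^bsub>G3\<^esub> a" for a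
      using that I1.lker I3.rker triv(1) by blast
    show "b = \<one>\<^bsub>G2\<^esub>" if "coset_rel G2 C2 G3 B3 \<phi>2 b \<one>\<^bsub>G3\<^esub>" "coset_rel G1 C1 G2 B2 \<phi>1 \<one>\<^bsub>G1\<^esub> b" for b
      using that I2.lker I1.rker triv(2) by blast
    show "c = \<one>\<^bsub>G3\<^esub>" if "coset_rel G3 C3 G1 B1 \<phi>3 c \<one>\<^bsub>G1\<^esub>" "coset_rel G2 C2 G3 B3 \<phi>2 \<one>\<^bsub>G2\<^esub> c" for c
      using that I3.lker I2.rker triv(3) by blast
    show "\<exists>b. coset_rel G1 C1 G2 B2 \<phi>1 \<one>\<^bsub>G1\<^esub> b \<and> coset_rel G2 C2 G3 B3 \<phi>2 b c"
      if "coset_rel G3 C3 G1 B1 \<phi>3 c \<one>\<^bsub>G1\<^esub>" for c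
      using that local_conditions_transfer[OF loc(2) normals(5) _ normals(6)] I3.lker I1.rker by blast
    show "\<exists>c. coset_rel G2 C2 G3 B3 \<phi>2 \<one>\<^bsub>G2\<^esub> c \<and> coset_rel G3 C3 G1 B1 \<phi>3 c a"
      if "coset_rel G1 C1 G2 B2 \<phi>1 a \<one>\<^bsub>G2\<^esub>" for a
      using that local_conditions_transfer[OF loc(3) normals(1) _ normals(2)] I1.lker I2.rker by blast
  next
    fix x y z x'
    assume xy: "coset_rel G1 C1 G2 B2 \<phi>1 x y" and yz: "coset_rel G2 C2 G3 B3 \<phi>2 y z"
      and zx': "coset_rel G3 C3 G1 B1 \<phi>3 z x'"
    have carr: "x \<in> carrier G1" "y \<in> carrier G2" "z \<in> carrier G3" "x' \<in> carrier G1"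
      using xy yz zx' by (auto simp: coset_rel_def)
    \<comment> \<open>Following \<open>x\<close> through \<open>y\<close> and \<open>z\<close>
      carries its coset to that of \<open>x'\<close>, while condition 6 returns it to
      itself.\<close>
    have "(B1 <#>\<^bsub>G1\<^esub> C1) #>\<^bsub>G1\<^esub> x = (B1 <#>\<^bsub>G1\<^esub> C1) #>\<^bsub>G1\<^esub> x'"
      using coc[OF carr(1)] xy yz zx'
        induced_coset[OF assms(1,2) loc(1) normals(4,3) carr(1,2)]
        induced_coset[OF assms(2,3) loc(2) normals(6,5) carr(2,3)]
        induced_coset[OF assms(3,1) loc(3) normals(2,1) carr(3,4)]
      by (simp add: coset_rel_def)
    moreover have "\<one>\<^bsub>G1\<^esub> \<in> B1 <#>\<^bsub>G1\<^esub> C1"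
      using I3.B.one_closed I1.C.one_closed set_mult_memI[of "\<one>\<^bsub>G1\<^esub>" B1 "\<one>\<^bsub>G1\<^esub>" C1 G1] by simp
    then have "x' \<in> (B1 <#>\<^bsub>G1\<^esub> C1) #>\<^bsub>G1\<^esub> x'"
      using carr r_coset_memI[of "\<one>\<^bsub>G1\<^esub>" _ G1 x'] by simp
    ultimately have "x' \<in> (B1 <#>\<^bsub>G1\<^esub> C1) #>\<^bsub>G1\<^esub> x" using carr by simp
    then obtain b c where b: "b \<in> B1" and c: "c \<in> C1" and x': "x' = b \<otimes>\<^bsub>G1\<^esub> c \<otimes>\<^bsub>G1\<^esub> x"
      by (auto simp: set_mult_def r_coset_def)
    have bc: "b \<in> carrier G1" "c \<in> carrier G1" using b c I3.B.subset I1.C.subset by auto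
    \<comment> \<open>Being related to the unit, \<open>b\<close> can be stripped from
      \<open>x'\<close> with \<open>z\<close> unchanged; only the factor \<open>c\<close> from
      \<open>C1\<close> remains.\<close>
    have "coset_rel G3 C3 G1 B1 \<phi>3 \<one>\<^bsub>G3\<^esub> b" using b I3.rker by blast
    from T3.mult[OF T3.inverse[OF this] zx']
    have "coset_rel G3 C3 G1 B1 \<phi>3 z (c \<otimes>\<^bsub>G1\<^esub> x)"
      using carr bc by (simp add: x' I1.C.m_assoc flip: I1.C.m_assoc[of "inv\<^bsub>G1\<^esub> b"])
    then show "\<exists>c. coset_rel G1 C1 G2 B2 \<phi>1 c \<one>\<^bsub>G2\<^esub> \<and> coset_rel G3 C3 G1 B1 \<phi>3 z (c \<otimes>\<^bsub>G1\<^esub> x)"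
      using c I1.lker by blast
  qed
qed

lemma glued_tuple:
  assumes "group G1" "group G2" "group G3" and t: "t \<in> gluing_tuples G1 G2 G3"
  shows "glued G1 G2 G3 t \<in> deg_2fi_subdirect G1 G2 G3"
    and "gluing_data_of G1 G2 G3 (glued G1 G2 G3 t) = t"
proof -
  obtain B1 B2 B3 C1 C2 C3 \<phi>1 \<phi>2 \<phi>3 where t_eq: "t = (B1, B2, B3, C1, C2, C3, \<phi>1, \<phi>2, \<phi>3)"
    by (metis prod.exhaust)
  interpret gluing G1 G2 G3 "coset_rel G1 C1 G2 B2 \<phi>1" "coset_rel G2 C2 G3 B3 \<phi>2"
    "coset_rel G3 C3 G1 B1 \<phi>3"
    using assms by (simp add: gluing_of_tuple t_eq)
  have mem: "(a, b, c) \<in> glued G1 G2 G3 t \<longleftrightarrow> R a b c" for a b c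
    unfolding t_eq mem_glued R_def ..
  show "glued G1 G2 G3 t \<in> deg_2fi_subdirect G1 G2 G3"
    using degenerate_triple_R by (simp add: mem_deg_2fi_subdirect_iff assms(1-3) mem)
  have loc: "local_conditions G1 B1 C1 G2 B2 C2 \<phi>1" "local_conditions G2 B2 C2 G3 B3 C3 \<phi>2"
    "local_conditions G3 B3 C3 G1 B1 C1 \<phi>3"
    using t by (auto simp: gluing_tuples_def t_eq)
  then have normals: "B1 \<lhd> G1" "B2 \<lhd> G2" "B3 \<lhd> G3"
    by (auto simp: local_conditions_def)
  note iso = local_conditions_coset_iso[OF loc(1) normals(2)]
    local_conditions_coset_iso[OF loc(2) normals(3)] local_conditions_coset_iso[OF loc(3) normals(1)]
  \<comment> \<open>By the pair lemmas the pairwise projections of the glued set are exactly the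
    relations of the tuple, and their kernels and coset maps return its components.\<close>
  show "gluing_data_of G1 G2 G3 (glued G1 G2 G3 t) = t"
    by (simp add: gluing_data_of_def proj_H mem pair1 pair2 pair3 iso[THEN coset_iso.lker]
        iso[THEN coset_iso.rker] iso[THEN coset_iso.coset_map_rel])
      (simp add: t_eq)
qed

text \<open>The tuple remembers the pairwise projections of \<open>\<Delta>\<close>, since
  \<open>coset_map_iff\<close> recovers each Goursat relation from its map.\<close>

lemma gluing_data_of_rel:
  assumes "group G1" "group G2" "group G3" and \<Delta>: "\<Delta> \<in> deg_2fi_subdirect G1 G2 G3"
    and F: "gluing_data_of G1 G2 G3 \<Delta> = (B1, B2, B3, C1, C2, C3, \<phi>1, \<phi>2, \<phi>3)"
  shows "coset_rel G1 C1 G2 B2 \<phi>1 a b \<longleftrightarrow> (\<exists>c. (a, b, c) \<in> \<Delta>)"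
    and "coset_rel G2 C2 G3 B3 \<phi>2 b c \<longleftrightarrow> (\<exists>a. (a, b, c) \<in> \<Delta>)"
    and "coset_rel G3 C3 G1 B1 \<phi>3 c a \<longleftrightarrow> (\<exists>b. (a, b, c) \<in> \<Delta>)"
proof -
  interpret T: degenerate_triple G1 G2 G3 "\<lambda>a b c. (a, b, c) \<in> \<Delta>"
    using assms by (simp add: mem_deg_2fi_subdirect_iff)
  note eqs = gluing_data_ofD[OF F]
  have rel: "coset_rel G {x. T x \<one>\<^bsub>H\<^esub>} H {y. T \<one>\<^bsub>G\<^esub> y} (coset_map G H T) x y \<longleftrightarrow> T x y"
    if T: "goursat_relation G H T" for G :: "('x, 'y) monoid_scheme" and H :: "('z, 'w) monoid_scheme"
      and T x y
    using goursat_relation.coset_map_iff[OF T, of x y] goursat_relation.left_carrier[OF T, of x y]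
      goursat_relation.right_carrier[OF T, of x y]
    by (auto simp: coset_rel_def)
  show "coset_rel G1 C1 G2 B2 \<phi>1 a b \<longleftrightarrow> (\<exists>c. (a, b, c) \<in> \<Delta>)"
    using rel[OF T.goursat] by (simp add: eqs)
  show "coset_rel G2 C2 G3 B3 \<phi>2 b c \<longleftrightarrow> (\<exists>a. (a, b, c) \<in> \<Delta>)"
    using rel[OF injective_triple.goursat[OF T.rotate]] by (simp add: eqs)
  show "coset_rel G3 C3 G1 B1 \<phi>3 c a \<longleftrightarrow> (\<exists>b. (a, b, c) \<in> \<Delta>)"
    using rel[OF injective_triple.goursat[OF injective_triple.rotate[OF T.rotate]]]
    by (simp add: eqs)
qed

text \<open>Membership in the glued set says only that each pair of coordinates occurs in
  \<open>\<Delta>\<close>; degeneracy, through \<open>pairs_determine\<close>, makes this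
  sufficient.\<close>

lemma glued_gluing_data_of:
  assumes "group G1" "group G2" "group G3" and \<Delta>: "\<Delta> \<in> deg_2fi_subdirect G1 G2 G3"
  shows "glued G1 G2 G3 (gluing_data_of G1 G2 G3 \<Delta>) = \<Delta>"
proof -
  interpret T: degenerate_triple G1 G2 G3 "\<lambda>a b c. (a, b, c) \<in> \<Delta>"
    using assms by (simp add: mem_deg_2fi_subdirect_iff)
  obtain B1 B2 B3 C1 C2 C3 \<phi>1 \<phi>2 \<phi>3
    where F: "gluing_data_of G1 G2 G3 \<Delta> = (B1, B2, B3, C1, C2, C3, \<phi>1, \<phi>2, \<phi>3)"
    by (metis prod.exhaust)
  have "(a, b, c) \<in> glued G1 G2 G3 (gluing_data_of G1 G2 G3 \<Delta>) \<longleftrightarrow> (a, b, c) \<in> \<Delta>" for a b c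
    unfolding F mem_glued gluing_data_of_rel[OF assms F] using T.pairs_determine by blast
  then show ?thesis by auto
qed

theorem theorem3p15:
  fixes G1 :: "('a, 'm) monoid_scheme" and G2 :: "('b, 'n) monoid_scheme"
    and G3 :: "('c, 'p) monoid_scheme"
  assumes "group G1" and "group G2" and "group G3"
  shows "\<exists>F :: ('a \<times> 'b \<times> 'c) set \<Rightarrow> ('a, 'b, 'c) gluing_data.
    bij_betw F (deg_2fi_subdirect G1 G2 G3) (gluing_tuples G1 G2 G3) \<and>
    (\<forall>\<Delta> \<in> deg_2fi_subdirect G1 G2 G3. \<forall>B1 B2 B3 C1 C2 C3 \<phi>1 \<phi>2 \<phi>3.
      F \<Delta> = (B1, B2, B3, C1, C2, C3, \<phi>1, \<phi>2, \<phi>3) \<longrightarrow>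
        B1 = proj1 ` H3 G3 \<Delta> \<and> B2 = proj2 ` H1 G1 \<Delta> \<and> B3 = proj3 ` H2 G2 \<Delta> \<and>
        C1 = proj1 ` H2 G2 \<Delta> \<and> C2 = proj2 ` H3 G3 \<Delta> \<and> C3 = proj3 ` H1 G1 \<Delta> \<and>
        (\<forall>(g1, g2, g3) \<in> \<Delta>.
          \<phi>1 (C1 #>\<^bsub>G1\<^esub> g1) = B2 #>\<^bsub>G2\<^esub> g2 \<and>
          \<phi>2 (C2 #>\<^bsub>G2\<^esub> g2) = B3 #>\<^bsub>G3\<^esub> g3 \<and>
          \<phi>3 (C3 #>\<^bsub>G3\<^esub> g3) = B1 #>\<^bsub>G1\<^esub> g1)) \<and>
    (\<forall>B1 B2 B3 C1 C2 C3 \<phi>1 \<phi>2 \<phi>3.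
      (B1, B2, B3, C1, C2, C3, \<phi>1, \<phi>2, \<phi>3) \<in> gluing_tuples G1 G2 G3 \<longrightarrow>
        inv_into (deg_2fi_subdirect G1 G2 G3) F (B1, B2, B3, C1, C2, C3, \<phi>1, \<phi>2, \<phi>3) =
          {(g1, g2, g3). (g1, g2, g3) \<in> carrier (prod3 G1 G2 G3) \<and>
            \<phi>1 (C1 #>\<^bsub>G1\<^esub> g1) = B2 #>\<^bsub>G2\<^esub> g2 \<and>
            \<phi>2 (C2 #>\<^bsub>G2\<^esub> g2) = B3 #>\<^bsub>G3\<^esub> g3 \<and>
            \<phi>3 (C3 #>\<^bsub>G3\<^esub> g3) = B1 #>\<^bsub>G1\<^esub> g1})"
proof -
  note groups = assms
  let ?F = "gluing_data_of G1 G2 G3" and ?D = "deg_2fi_subdirect G1 G2 G3"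
  \<comment> \<open>The simplification rule of \<open>glued\<close> is switched off so that the
    constant stays folded and the inverse laws can rewrite it.\<close>
  have bij: "bij_betw ?F ?D (gluing_tuples G1 G2 G3)"
    by (rule bij_betw_byWitness[where f' = "glued G1 G2 G3"])
      (auto simp: groups gluing_data_of_mem glued_tuple glued_gluing_data_of
        simp del: glued.simps)
  \<comment> \<open>\<open>inv_into\<close> chooses some preimage; \<open>glued\<close> provides
    one, and injectivity leaves no other.\<close>
  have inv: "inv_into ?D ?F t = glued G1 G2 G3 t" if "t \<in> gluing_tuples G1 G2 G3" for t
    using inv_into_f_f[OF bij_betw_imp_inj_on[OF bij] glued_tuple(1)[OF groups that]]
    by (simp add: glued_tuple(2)[OF groups that])
  show ?thesis
  proof (rule exI[of _ ?F], intro conjI ballI allI impI)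
    fix \<Delta> B1 B2 B3 C1 C2 C3 \<phi>1 \<phi>2 \<phi>3
    assume \<Delta>: "\<Delta> \<in> ?D" and F: "?F \<Delta> = (B1, B2, B3, C1, C2, C3, \<phi>1, \<phi>2, \<phi>3)"
    show "B1 = proj1 ` H3 G3 \<Delta>" "B2 = proj2 ` H1 G1 \<Delta>" "B3 = proj3 ` H2 G2 \<Delta>"
      "C1 = proj1 ` H2 G2 \<Delta>" "C2 = proj2 ` H3 G3 \<Delta>" "C3 = proj3 ` H1 G1 \<Delta>"
      using F by (simp_all add: gluing_data_of_def)
    fix g assume "g \<in> \<Delta>"
    then show "case g of (g1, g2, g3) \<Rightarrow>
        \<phi>1 (C1 #>\<^bsub>G1\<^esub> g1) = B2 #>\<^bsub>G2\<^esub> g2 \<and>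
        \<phi>2 (C2 #>\<^bsub>G2\<^esub> g2) = B3 #>\<^bsub>G3\<^esub> g3 \<and>
        \<phi>3 (C3 #>\<^bsub>G3\<^esub> g3) = B1 #>\<^bsub>G1\<^esub> g1"
      using gluing_data_of_rel[OF groups \<Delta> F] unfolding coset_rel_def by blast
  next
    fix B1 B2 B3 C1 C2 C3 \<phi>1 \<phi>2 \<phi>3
    assume t: "(B1, B2, B3, C1, C2, C3, \<phi>1, \<phi>2, \<phi>3) \<in> gluing_tuples G1 G2 G3"
    show "inv_into ?D ?F (B1, B2, B3, C1, C2, C3, \<phi>1, \<phi>2, \<phi>3) =
        {(g1, g2, g3). (g1, g2, g3) \<in> carrier (prod3 G1 G2 G3) \<and>
          \<phi>1 (C1 #>\<^bsub>G1\<^esub> g1) = B2 #>\<^bsub>G2\<^esub> g2 \<and>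
          \<phi>2 (C2 #>\<^bsub>G2\<^esub> g2) = B3 #>\<^bsub>G3\<^esub> g3 \<and>
          \<phi>3 (C3 #>\<^bsub>G3\<^esub> g3) = B1 #>\<^bsub>G1\<^esub> g1}"
      unfolding inv[OF t] glued.simps ..
  qed (rule bij)
qed

end
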